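(* The harmonic measure of the real slice $M\cap\mathbb{R}=[-2,1/4]$ of the Mandelbrot set is zero: $\mu_M([-2,1/4])=0$. That is, the set of angles $t\in\mathbb{T}$ for which the parameter ray $R_M(t)$ lands at a point of $[-2,1/4]$ has Lebesgue measure zero.
   Context: $\mathbb{T}=\mathbb{R}/\mathbb{Z}$, with normalized Lebesgue measure $m$. For $c\in\mathbb{C}$ let $Q_c(z)=z^2+c$. The Mandelbrot set $M$ is the set of $c\in\mathbb{C}$ for which the Julia set of $Q_c$ is connected; it is compact, full and connected, and $M\cap\mathbb{R}=[-2,1/4]$. Let $\Phi:\widehat{\mathbb{C}}\smallsetminus M\to\widehat{\mathbb{C}}\smallsetminus\overline{\mathbb{D}}$ be the conformal isomorphism with $\Phi(\infty)=\infty$, $\Phi'(\infty)=1$. The parameter ray of angle $t\in\mathbb{T}$ is $R_M(t)=\Phi^{-1}\{re^{2\pi i t}:r>1\}$; it lands at $c\in\partial M$ if $\lim_{r\to1^+}\Phi^{-1}(re^{2\pi i t})=c$. For a Borel set $S\subset M$, the harmonic measure is $\mu_M(S)=m\{t\in\mathbb{T}:R_M(t)\text{ lands at a point of }S\}$. *)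

theory Defs
  imports "HOL-Complex_Analysis.Complex_Analysis"
begin

definition quad :: "complex \<Rightarrow> complex \<Rightarrow> complex" where
  "quad c z = z\<^sup>2 + c"

definition filled_julia :: "complex \<Rightarrow> complex set" where
  "filled_julia c = {z. bounded (range (\<lambda>n. (quad c ^^ n) z))}"

definition julia :: "complex \<Rightarrow> complex set" where
  "julia c = frontier (filled_julia c)"

definition mandelbrot :: "complex set" where
  "mandelbrot = {c. connected (julia c)}"

text \<open>
  The conformal isomorphism between the complements, in the Riemann sphere, of the
  Mandelbrot set and of the closed unit disc is represented by its restriction to the finite
  plane. The last two conditions express its normalization at infinity: it fixes infinity, and
  its derivative there, taken in the coordinate \<open>1/z\<close>, is 1. Holomorphy at infinity is then
  automatic by removability of the singularity. These conditions determine \<open>\<Phi>\<close> uniquely on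
  the complement of the Mandelbrot set; its values on the Mandelbrot set are irrelevant.
\<close>

definition exterior_riemann_map :: "(complex \<Rightarrow> complex) \<Rightarrow> bool" where
  "exterior_riemann_map \<Phi> \<longleftrightarrow>
     \<Phi> holomorphic_on (- mandelbrot) \<and>
     bij_betw \<Phi> (- mandelbrot) (- cball 0 1) \<and>
     filterlim \<Phi> at_infinity at_infinity \<and>
     ((\<lambda>c. \<Phi> c / c) \<longlongrightarrow> 1) at_infinity"

text \<open>The parameter ray of angle \<open>t\<close>, parametrized by \<open>r > 1\<close>.\<close>

definition parameter_ray :: "(complex \<Rightarrow> complex) \<Rightarrow> real \<Rightarrow> real \<Rightarrow> complex" where
  "parameter_ray \<Phi> t r = inv_into (- mandelbrot) \<Phi> (of_real r * cis (2 * pi * t))"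

definition ray_lands_at :: "(complex \<Rightarrow> complex) \<Rightarrow> real \<Rightarrow> complex \<Rightarrow> bool" where
  "ray_lands_at \<Phi> t c \<longleftrightarrow>
     c \<in> frontier mandelbrot \<and> (parameter_ray \<Phi> t \<longlongrightarrow> c) (at_right 1)"

text \<open>
  The circle \<open>\<real>/\<int>\<close> with normalized Lebesgue measure is represented by the fundamental
  domain \<open>[0,1)\<close>.
\<close>

definition landing_angles :: "(complex \<Rightarrow> complex) \<Rightarrow> complex set \<Rightarrow> real set" where
  "landing_angles \<Phi> S = {t \<in> {0..<1}. \<exists>c\<in>S. ray_lands_at \<Phi> t c}"

text \<open>
  As \<^const>\<open>emeasure\<close> is 0 on non-measurable sets, a vanishing value is informative only
  together with measurability of the set of angles.
\<close>

definition harmonic_measure :: "(complex \<Rightarrow> complex) \<Rightarrow> complex set \<Rightarrow> ennreal" where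
  "harmonic_measure \<Phi> S = emeasure lebesgue (landing_angles \<Phi> S)"

end

theory Submission
  imports Defs "HOL-Real_Asymp.Real_Asymp"
begin

text \<open>
  Write \<open>P\<^sub>n(c)\<close> for the \<open>n\<close>-th point of the orbit of the critical value \<open>c\<close> under \<open>z\<^sup>2 + c\<close>, a monic
  polynomial of degree \<open>2^n\<close> in \<open>c\<close>. By the Fatou--Julia dichotomy (\<open>mandelbrot_eq\<close>) the Mandelbrot
  set \<open>M\<close> is the set of \<open>c\<close> with \<open>\<bar>P\<^sub>n(c)\<bar> \<le> 2\<close> for all \<open>n\<close>, which in particular gives the real slice.

  Off \<open>M\<close>, the value \<open>P\<^sub>n(c)\<close> is comparable with \<open>\<Phi>(c)^(2^n)\<close>, with constants that do not depend on
  \<open>n\<close>: \<open>\<bar>\<Phi>(c)\<bar>^(2^n) - 3 \<le> \<bar>P\<^sub>n(c)\<bar> \<le> 2 \<bar>\<Phi>(c)\<bar>^(2^n)\<close> for \<open>\<bar>c\<bar> \<le> 6\<close> (\<open>critical_orbit_lower_bound\<close>,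
  \<open>critical_orbit_upper_bound\<close>). Hence at the points \<open>c\<close> with
  \<open>\<bar>\<Phi>(c)\<bar>^(2^n) = X\<close>, where \<open>X\<close> is a large constant, \<open>\<bar>P\<^sub>n(c)\<bar>\<close> is about \<open>X\<close>. These points are, in
  the coordinate \<open>\<Phi>\<close>, at distance about \<open>2^(-n)\<close> from the unit circle.

  On the other hand, if \<open>c\<close> lies in \<open>[-2 + \<delta>, 1/4]\<close>, then its critical orbit stays in the
  interval \<open>[-2 + \<delta>, 2 - \<delta>]\<close>. An interval of length less than 4 has logarithmic capacity less than 1,
  so a scaled Chebyshev polynomial gives a monic \<open>T\<close> of some degree \<open>N\<close> with \<open>\<bar>T\<bar> < 1/8\<close> on it.
  Consider the bounded holomorphic functions \<open>T(P\<^sub>n(c)) / \<Phi>(c)^(N 2^n)\<close> in the exterior disc coordinate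
  \<open>\<Phi>(c)\<close>. Their radial limits are at most \<open>1/8\<close> in modulus at every angle whose ray
  lands in \<open>[-2 + \<delta>, 1/4]\<close>. If these angles formed a set of positive measure, some dyadic
  interval \<open>I\<close> of length \<open>2^(-j)\<close> would consist of them up to a small proportion
  (\<open>dense_dyadic_interval\<close>). Above the midpoint of \<open>I\<close>, at a height which is a small but fixed multiple
  of \<open>2^(-j)\<close>, almost all harmonic measure is carried by the angles in \<open>I\<close> of small radial limit, so that
  the function is at most \<open>7/32\<close> there (\<open>radial_bound\<close>). But for \<open>n\<close> equal to \<open>j\<close> plus a constant,
  this is a point where \<open>\<bar>\<Phi>(c)\<bar>^(2^n) = X\<close>, and the growth of \<open>P\<^sub>n\<close> makes the modulus at least \<open>3/8\<close>.
  This contradiction is \<open>landing_angles_null\<close>.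

  Letting \<open>\<delta>\<close> tend to 0 leaves only the point \<open>-2\<close>. Its critical orbit is eventually constant equal to 2,
  and \<open>T(z) = z - 2\<close> does the same job.
\<close>

section \<open>Connectedness of Julia sets\<close>

lemma quad_holomorphic: "quad c holomorphic_on A"
  unfolding quad_def by (intro holomorphic_intros)

lemma quad_funpow_holomorphic: "(quad c ^^ n) holomorphic_on A"
proof (induction n)
  case (Suc n)
  then show ?case
    unfolding funpow.simps by (intro holomorphic_on_compose quad_holomorphic)
qed (simp add: id_def)

lemma quad_funpow_continuous: "continuous_on A (quad c ^^ n)"
  by (rule holomorphic_on_imp_continuous_on[OF quad_funpow_holomorphic])

lemma quad_expands:
  assumes "norm z > 2" "norm z \<ge> norm c"
  shows "norm (quad c z) \<ge> norm z * (norm z - 1)" "norm (quad c z) > norm z"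
proof -
  have "norm (z\<^sup>2) \<le> norm (quad c z) + norm c"
    unfolding quad_def by (metis add_diff_cancel_right' norm_triangle_ineq4)
  hence "norm (quad c z) \<ge> norm z ^ 2 - norm z"
    using assms by (simp add: norm_power)
  thus *: "norm (quad c z) \<ge> norm z * (norm z - 1)"
    by (simp add: power2_eq_square algebra_simps)
  have "norm z * 1 < norm z * (norm z - 1)"
    using assms by (intro mult_strict_left_mono) auto
  with * show "norm (quad c z) > norm z" by linarith
qed

lemma quad_escape:
  assumes "norm z > 2" "norm z \<ge> norm c"
  shows "z \<notin> filled_julia c"
proof
  assume "z \<in> filled_julia c"
  then obtain B where B: "\<And>n. norm ((quad c ^^ n) z) \<le> B"
    unfolding filled_julia_def bounded_iff by auto
  have *: "norm z * (norm z - 1) ^ n \<le> norm ((quad c ^^ n) z) \<and> norm z \<le> norm ((quad c ^^ n) z)" for n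
  proof (induction n)
    case (Suc n)
    let ?w = "(quad c ^^ n) z"
    have w: "norm ?w > 2" "norm ?w \<ge> norm c" using Suc assms by auto
    have "norm z * (norm z - 1) ^ Suc n = (norm z * (norm z - 1) ^ n) * (norm z - 1)" by simp
    also have "\<dots> \<le> norm ?w * (norm ?w - 1)"
      using Suc assms by (intro mult_mono) auto
    also have "\<dots> \<le> norm ((quad c ^^ Suc n) z)" using quad_expands[OF w] by simp
    finally show ?case using quad_expands(2)[OF w] Suc by auto
  qed auto
  obtain n where "B < (norm z - 1) ^ n"
    using real_arch_pow[of "norm z - 1" B] assms by auto
  also have "\<dots> \<le> norm z * (norm z - 1) ^ n"
    using assms by (simp add: mult_le_cancel_right1)
  also have "\<dots> \<le> B" using * B by (meson order_trans)
  finally show False by simp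
qed

lemma funpow_quad_filled_julia_iff:
  "(quad c ^^ n) z \<in> filled_julia c \<longleftrightarrow> z \<in> filled_julia c"
proof -
  have "bounded (range (\<lambda>m. (quad c ^^ m) (quad c z))) \<longleftrightarrow> bounded (range (\<lambda>m. (quad c ^^ m) z))" for z
  proof -
    have "range (\<lambda>m. (quad c ^^ m) z) = insert z (range (\<lambda>m. (quad c ^^ m) (quad c z)))"
    proof -
      have "UNIV = insert 0 (range Suc)" using UNIV_nat_eq by blast
      hence "range (\<lambda>m. (quad c ^^ m) z) = (\<lambda>m. (quad c ^^ m) z) ` insert 0 (range Suc)" by simp
      also have "\<dots> = insert z (range (\<lambda>m. (quad c ^^ Suc m) z))"
        by (simp only: image_insert image_image) simp
      finally show ?thesis by (simp add: funpow_swap1)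
    qed
    thus ?thesis by simp
  qed
  hence *: "quad c z \<in> filled_julia c \<longleftrightarrow> z \<in> filled_julia c" for z
    by (simp add: filled_julia_def)
  show ?thesis by (induction n) (auto simp: *)
qed

lemma quad_filled_julia_iff: "quad c z \<in> filled_julia c \<longleftrightarrow> z \<in> filled_julia c"
  using funpow_quad_filled_julia_iff[of 1 c z] by simp

lemma filled_julia_eq:
  "filled_julia c = (\<Inter>n. {z. norm ((quad c ^^ n) z) \<le> max 2 (norm c)})" (is "_ = ?R")
proof (intro equalityI subsetI)
  fix z assume "z \<in> ?R"
  thus "z \<in> filled_julia c"
    unfolding filled_julia_def bounded_iff by auto
next
  fix z assume "z \<in> filled_julia c"
  hence "norm ((quad c ^^ n) z) \<le> max 2 (norm c)" for n
    using quad_escape[of "(quad c ^^ n) z" c] funpow_quad_filled_julia_iff[of n c z]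
    by (force simp: max_def)
  thus "z \<in> ?R" by auto
qed

lemma compact_filled_julia: "compact (filled_julia c)"
proof -
  have "closed {z. norm ((quad c ^^ n) z) \<le> max 2 (norm c)}" for n
    by (intro closed_Collect_le continuous_intros quad_funpow_continuous)
  hence "closed (filled_julia c)" unfolding filled_julia_eq by auto
  moreover have "filled_julia c \<subseteq> {z. norm ((quad c ^^ 0) z) \<le> max 2 (norm c)}"
    unfolding filled_julia_eq by blast
  hence "bounded (filled_julia c)"
    by (intro bounded_subset[OF bounded_cball[of 0 "max 2 (norm c)"]]) auto
  ultimately show ?thesis by (simp add: compact_eq_bounded_closed)
qed

lemma filled_julia_nonempty: "filled_julia c \<noteq> {}"
proof -
  define z where "z = (1 + csqrt (1 - 4 * c)) / 2"
  have "csqrt (1 - 4 * c) ^ 2 = 1 - 4 * c" by simp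
  hence c: "c = (1 - csqrt (1 - 4 * c) ^ 2) / 4" by simp
  have z: "quad c z = z"
    unfolding quad_def z_def by (subst (2) c) (simp add: field_simps power2_eq_square)
  have "(quad c ^^ n) z = z" for n by (induction n) (auto simp: z)
  hence "z \<in> filled_julia c" by (simp add: filled_julia_def)
  thus ?thesis by blast
qed

text \<open>
  On the boundary of a bounded complementary component all iterates are bounded by the escape radius,
  hence also inside it by the maximum principle. So every complementary component is unbounded, and
  a bounded set has only one of these.
\<close>

lemma connected_Compl_filled_julia: "connected (- filled_julia c)"
proof -
  let ?K = "filled_julia c"
  have K: "closed ?K" "bounded ?K"
    using compact_filled_julia by (auto simp: compact_eq_bounded_closed)
  have unb: "\<not> bounded C" if C: "C \<in> components (- ?K)" for C
  proof
    assume bd: "bounded C"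
    have fr: "frontier C \<subseteq> ?K" by (rule frontier_of_components_closed_complement[OF K(1) C])
    obtain z where z: "z \<in> C" using C in_components_nonempty by blast
    have "norm ((quad c ^^ n) z) \<le> max 2 (norm c)" for n
      by (rule maximum_modulus_frontier[OF quad_funpow_holomorphic quad_funpow_continuous bd _ z])
        (use fr in \<open>auto simp: filled_julia_eq\<close>)
    hence "z \<in> ?K" by (simp add: filled_julia_eq)
    thus False using z C in_components_subset by blast
  qed
  have "C = D" if "C \<in> components (- ?K)" "D \<in> components (- ?K)" for C D
    using cobounded_unique_unbounded_components[of "- ?K" C D] that unb K by auto
  thus ?thesis by (simp add: connected_eq_connected_components_eq)
qed

text \<open>
  The orbit starts at the critical value \<open>c\<close> and not at the critical point 0, so that its
  \<open>n\<close>-th point is a monic polynomial of degree \<open>2^n\<close> in \<open>c\<close>.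
\<close>

definition critical_orbit :: "nat \<Rightarrow> complex \<Rightarrow> complex" where
  "critical_orbit n c = (quad c ^^ n) c"

lemma critical_orbit_0 [simp]: "critical_orbit 0 c = c"
  by (simp add: critical_orbit_def)

lemma critical_orbit_Suc: "critical_orbit (Suc n) c = (critical_orbit n c)\<^sup>2 + c"
  by (simp add: critical_orbit_def quad_def)

lemma critical_value_in_filled_julia_iff: 
  "c \<in> filled_julia c \<longleftrightarrow> (\<forall>n. norm (critical_orbit n c) \<le> 2)"
proof
  assume "\<forall>n. norm (critical_orbit n c) \<le> 2"
  thus "c \<in> filled_julia c"
    unfolding filled_julia_def bounded_iff critical_orbit_def by blast
next
  assume c: "c \<in> filled_julia c"
  hence "norm c \<le> 2" using quad_escape[of c c] by force
  thus "\<forall>n. norm (critical_orbit n c) \<le> 2"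
    using c by (auto simp: filled_julia_eq critical_orbit_def max_def split: if_splits)
qed

lemma open_quad_image:
  assumes "open U"
  shows "open (quad c ` U)"
proof (rule open_mapping_thm[OF quad_holomorphic[of c UNIV] _ _ assms])
  have "quad c 0 \<noteq> quad c 1" by (simp add: quad_def)
  thus "\<not> quad c constant_on UNIV" unfolding constant_on_def by (metis UNIV_I)
qed auto

lemma quad_continuous: "continuous_on A (quad c)"
  by (rule holomorphic_on_imp_continuous_on[OF quad_holomorphic])

lemma compact_quad_vimage:
  assumes "compact A"
  shows "compact (quad c -` A)"
proof -
  obtain B where B: "\<And>w. w \<in> A \<Longrightarrow> norm w \<le> B"
    using assms compact_imp_bounded bounded_iff by metis
  have "norm z \<le> 1 + B + norm c" if "quad c z \<in> A" for z
  proof -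
    have "norm z ^ 2 = norm (quad c z - c)" by (simp add: quad_def norm_power)
    also have "\<dots> \<le> B + norm c"
      using B[OF that] norm_triangle_ineq4[of "quad c z" c] by linarith
    finally have "norm z ^ 2 \<le> B + norm c" .
    moreover have "2 * norm z \<le> 1 + norm z ^ 2"
      using sum_squares_ge_zero[of "norm z - 1" 0] by (simp add: power2_eq_square algebra_simps)
    ultimately show ?thesis using norm_ge_zero[of z] by linarith
  qed
  hence "bounded (quad c -` A)" unfolding bounded_iff by blast
  moreover have "closed (quad c -` A)"
    using assms by (intro closed_vimage compact_imp_closed quad_continuous) auto
  ultimately show ?thesis by (simp add: compact_eq_bounded_closed)
qed

text \<open>
  The quadratic map is open and closed, so it maps every nonempty relatively clopen part of the preimage
  onto the connected set \<open>A\<close>. Each such part therefore contains a preimage of the critical value \<open>c\<close>. As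
  0 is the only one, two disjoint parts cannot coexist.
\<close>

lemma connected_quad_vimage:
  assumes A: "compact A" "connected A" "c \<in> A"
  shows "connected (quad c -` A)"
proof -
  let ?B = "quad c -` A"
  have onto: "quad c ` T = A"
    if T: "openin (top_of_set ?B) T" "closedin (top_of_set ?B) T" "T \<noteq> {}" for T
  proof -
    obtain U where U: "open U" "T = ?B \<inter> U" using T(1) by (auto simp: openin_open)
    have "quad c ` T = A \<inter> quad c ` U" using U(2) by auto
    hence "openin (top_of_set A) (quad c ` T)"
      using open_quad_image[OF U(1)] by (auto simp: openin_open)
    moreover have "compact T"
      using T(2) compact_quad_vimage[OF A(1)] closedin_compact by blast
    hence "compact (quad c ` T)" by (intro compact_continuous_image quad_continuous)
    hence "closedin (top_of_set A) (quad c ` T)"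
      using U(2) by (intro closed_subset) (auto intro: compact_imp_closed)
    ultimately show ?thesis using A(2) T(3) by (auto simp: connected_clopen)
  qed
  have zero: "0 \<in> T" 
    if T: "openin (top_of_set ?B) T" "closedin (top_of_set ?B) T" "T \<noteq> {}" for T
    using onto[OF T] A(3) by (auto simp: quad_def image_iff)
  show ?thesis unfolding connected_clopen
  proof (intro allI impI, elim conjE)
    fix T assume T: "openin (top_of_set ?B) T" "closedin (top_of_set ?B) T"
    have T': "openin (top_of_set ?B) (?B - T)" "closedin (top_of_set ?B) (?B - T)"
      using T by (auto intro: openin_diff closedin_diff)
    show "T = {} \<or> T = ?B"
    proof (rule ccontr)
      assume *: "\<not> (T = {} \<or> T = ?B)"
      hence "?B - T \<noteq> {}" using T(1) openin_imp_subset by blast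
      hence "0 \<in> ?B - T" using zero[OF T'] by blast
      moreover have "0 \<in> T" using zero[OF T] * by blast
      ultimately show False by blast
    qed
  qed
qed

text \<open>
  The filled Julia set is the decreasing intersection of the preimages of a large disc under the iterates.
  All of these contain the critical value, so each is connected because the previous one is.
\<close>

lemma connected_filled_julia:
  assumes c: "c \<in> filled_julia c"
  shows "connected (filled_julia c)"
proof -
  define R where "R = max 2 (norm c)"
  define L where "L n = {z. norm ((quad c ^^ n) z) \<le> R}" for n
  have K: "filled_julia c = \<Inter> (range L)" unfolding L_def R_def by (rule filled_julia_eq)
  have L: "compact (L n) \<and> connected (L n)" for n
  proof (induction n)
    case 0
    have "L 0 = cball 0 R" by (auto simp: L_def)
    thus ?case by simp
  next
    case (Suc n)
    have "L (Suc n) = quad c -` L n" by (auto simp: L_def funpow_swap1)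
    moreover have "c \<in> L n" using c K by blast
    ultimately show ?case
      using Suc compact_quad_vimage connected_quad_vimage by simp
  qed
  have "L (Suc n) \<subseteq> L n" for n
  proof
    fix z assume z: "z \<in> L (Suc n)"
    show "z \<in> L n"
      using z quad_expands(2)[of "(quad c ^^ n) z" c] by (force simp: L_def R_def)
  qed
  hence "L n \<subseteq> L m" if "m \<le> n" for m n using that by (rule lift_Suc_antimono_le)
  thus ?thesis unfolding K using L by (intro connected_nest) auto
qed

lemma quad_vimage_julia: "quad c -` julia c = julia c"
proof (intro set_eqI)
  fix z
  let ?K = "filled_julia c"
  have "quad c z \<in> frontier ?K \<longleftrightarrow> z \<in> frontier ?K"
  proof
    assume *: "quad c z \<in> frontier ?K"
    show "z \<in> frontier ?K"
      unfolding frontier_straddle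
    proof (intro allI impI)
      fix e :: real assume "e > 0"
      have "open (quad c ` ball z e)" by (intro open_quad_image) auto
      moreover have "quad c z \<in> quad c ` ball z e" using \<open>e > 0\<close> by auto
      ultimately obtain d where d: "d > 0" "ball (quad c z) d \<subseteq> quad c ` ball z e"
        by (meson open_contains_ball)
      have fr: "\<exists>x\<in>?K. dist (quad c z) x < d" "\<exists>x. x \<notin> ?K \<and> dist (quad c z) x < d"
        using * d(1) unfolding frontier_straddle by blast+
      from fr(1) obtain x where x: "x \<in> ?K" "x \<in> ball (quad c z) d" by auto
      from fr(2) obtain y where y: "y \<notin> ?K" "y \<in> ball (quad c z) d" by auto
      from x d(2) obtain x' where x': "x' \<in> ball z e" "x = quad c x'" by blast
      from y d(2) obtain y' where y': "y' \<in> ball z e" "y = quad c y'" by blast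
      have "x' \<in> ?K" "y' \<notin> ?K" using x y x' y' by (simp_all add: quad_filled_julia_iff)
      thus "(\<exists>x\<in>?K. dist z x < e) \<and> (\<exists>x. x \<notin> ?K \<and> dist z x < e)"
        using x'(1) y'(1) by auto
    qed
  next
    assume *: "z \<in> frontier ?K"
    have K: "closed ?K" using compact_filled_julia compact_imp_closed by blast
    hence "z \<in> ?K" using * frontier_subset_closed by blast
    hence 1: "quad c z \<in> ?K" by (simp add: quad_filled_julia_iff)
    have "quad c z \<notin> interior ?K"
    proof
      assume "quad c z \<in> interior ?K"
      hence "z \<in> quad c -` interior ?K" by simp
      moreover have "open (quad c -` interior ?K)"
        by (intro open_vimage quad_continuous) auto
      moreover have "quad c -` interior ?K \<subseteq> ?K"
        using interior_subset quad_filled_julia_iff by blast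
      ultimately have "z \<in> interior ?K" by (meson interiorI)
      thus False using * by (simp add: frontier_def)
    qed
    with 1 show "quad c z \<in> frontier ?K"
      using K by (simp add: frontier_def)
  qed
  thus "z \<in> quad c -` julia c \<longleftrightarrow> z \<in> julia c" by (simp add: julia_def)
qed

text \<open>
  The critical value \<open>c\<close> can be joined to infinity outside the filled Julia set \<open>K\<close>, so \<open>z - c\<close> has a
  continuous square root \<open>s\<close> on \<open>K\<close>: this is Borsuk's theorem on compact plane sets with connected
  complement. The inverse branches \<open>s\<close> and \<open>-s\<close> split the completely invariant Julia set into two
  disjoint closed pieces.
\<close>

lemma disconnected_julia:
  assumes c: "c \<notin> filled_julia c"
  shows "\<not> connected (julia c)"
proof
  assume conn: "connected (julia c)"
  let ?K = "filled_julia c" and ?J = "julia c"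
  have JK: "?J \<subseteq> ?K" unfolding julia_def
    using compact_filled_julia compact_imp_closed frontier_subset_closed by blast
  have cJ: "compact ?J" unfolding julia_def
    using compact_filled_julia compact_frontier by blast
  have J0: "?J \<noteq> {}"
    unfolding julia_def using compact_filled_julia[of c] filled_julia_nonempty[of c] not_bounded_UNIV
    by (metis compact_imp_bounded frontier_eq_empty)
  have "Borsukian ?K"
    using Borsukian_separation_compact compact_filled_julia connected_Compl_filled_julia by blast
  moreover have "continuous_on ?K (\<lambda>z. z - c)" by (intro continuous_intros)
  moreover have "(\<lambda>z. z - c) \<in> ?K \<rightarrow> - {0}" using c by auto
  ultimately obtain g where g: "continuous_on ?K g" "\<And>z. z \<in> ?K \<Longrightarrow> z - c = exp (g z)"
    unfolding Borsukian_continuous_logarithm by blast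
  define s where "s z = exp (g z / 2)" for z
  have s2: "s z ^ 2 = z - c" if "z \<in> ?K" for z
    using g(2)[OF that] exp_double[of "g z / 2"] by (simp add: s_def)
  have sJ: "continuous_on ?J s"
    unfolding s_def using continuous_on_subset[OF g(1) JK] by (intro continuous_intros) auto
  let ?A = "s ` ?J" and ?B = "(\<lambda>z. - s z) ` ?J"
  have "compact ?A" "compact ?B"
    using cJ sJ by (auto intro!: compact_continuous_image continuous_intros)
  hence "closed ?A" "closed ?B" by (auto intro: compact_imp_closed)
  moreover have "?A \<inter> ?B = {}"
  proof -
    have False if "z \<in> ?J" "w \<in> ?J" "s z = - s w" for z w
    proof -
      have zw: "z \<in> ?K" "w \<in> ?K" using that JK by auto
      have "s z ^ 2 = s w ^ 2" unfolding that(3) by (rule power2_minus)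
      hence "z - c = w - c" unfolding s2[OF zw(1)] s2[OF zw(2)] .
      hence "s w = - s w" using that(3) by (metis diff_add_cancel)
      thus False by (simp add: s_def)
    qed
    thus ?thesis by blast
  qed
  moreover have "?J = ?A \<union> ?B"
  proof (intro equalityI subsetI)
    fix z assume z: "z \<in> ?J"
    hence Q: "quad c z \<in> ?J" using quad_vimage_julia[of c] by blast
    have "s (quad c z) ^ 2 = z ^ 2" using s2[of "quad c z"] Q JK by (auto simp: quad_def)
    hence "z = s (quad c z) \<or> z = - s (quad c z)" by (metis power2_eq_iff)
    thus "z \<in> ?A \<union> ?B" using Q by blast
  next
    fix z assume "z \<in> ?A \<union> ?B"
    then obtain w where w: "w \<in> ?J" "z = s w \<or> z = - s w" by blast
    hence "z\<^sup>2 = w - c" using s2[of w] JK by auto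
    hence "quad c z = w" by (simp add: quad_def)
    thus "z \<in> ?J" using w(1) quad_vimage_julia[of c] by blast
  qed
  moreover have "?A \<noteq> {}" "?B \<noteq> {}" using J0 by simp_all
  ultimately have "\<exists>A B. closed A \<and> closed B \<and> A \<noteq> {} \<and> B \<noteq> {} \<and> A \<union> B = ?J \<and> A \<inter> B = {}"
    by (intro exI[of _ ?A] exI[of _ ?B]) simp
  thus False
    using conn connected_closed_set[OF compact_imp_closed[OF cJ]] by simp
qed

theorem mandelbrot_eq: "mandelbrot = {c. \<forall>n. norm (critical_orbit n c) \<le> 2}"
proof -
  have "connected (julia c) \<longleftrightarrow> c \<in> filled_julia c" for c
    using disconnected_julia[of c] connected_frontier_simple[of "filled_julia c"]
      connected_filled_julia[of c] connected_Compl_filled_julia[of c]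
    unfolding julia_def by blast
  thus ?thesis by (auto simp: mandelbrot_def critical_value_in_filled_julia_iff)
qed

section \<open>The real slice and the orbit of the critical value\<close>

text \<open>
  For \<open>x \<le> 0\<close> the interval \<open>[-\<bar>x\<bar>, \<bar>x\<bar>]\<close> is invariant under \<open>y\<^sup>2 + x\<close> because \<open>x\<^sup>2 \<le> 2 \<bar>x\<bar>\<close>; for
  \<open>x \<in> [0, 1/4]\<close> the interval \<open>[-1/2, 1/2]\<close> is.
\<close>

lemma critical_orbit_real:
  assumes "-2 \<le> x" "x \<le> 1/4"
  obtains y where "critical_orbit n (of_real x) = of_real y" "\<bar>y\<bar> \<le> max \<bar>x\<bar> (1/2)"
proof -
  have "\<exists>y. critical_orbit n (of_real x) = of_real y \<and> \<bar>y\<bar> \<le> max \<bar>x\<bar> (1/2)"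
  proof (cases "x \<le> 0")
    case True
    have "\<exists>y. critical_orbit n (of_real x) = of_real y \<and> \<bar>y\<bar> \<le> \<bar>x\<bar>"
    proof (induction n)
      case (Suc n)
      then obtain y where y: "critical_orbit n (of_real x) = of_real y" "\<bar>y\<bar> \<le> \<bar>x\<bar>" by auto
      have "y\<^sup>2 \<le> x\<^sup>2" using y(2) by (simp add: abs_le_square_iff)
      moreover have "x\<^sup>2 \<le> -2 * x"
        using mult_right_mono_neg[of "-2" x x] assms True by (simp add: power2_eq_square)
      ultimately have "\<bar>y\<^sup>2 + x\<bar> \<le> \<bar>x\<bar>" using True zero_le_power2[of y] by linarith
      thus ?case using y(1) by (intro exI[of _ "y\<^sup>2 + x"]) (simp add: critical_orbit_Suc)
    qed auto
    thus ?thesis by (auto simp: le_max_iff_disj)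
  next
    case False
    have "\<exists>y. critical_orbit n (of_real x) = of_real y \<and> \<bar>y\<bar> \<le> 1/2"
    proof (induction n)
      case 0
      then show ?case using False assms by (intro exI[of _ x]) auto
    next
      case (Suc n)
      then obtain y where y: "critical_orbit n (of_real x) = of_real y" "\<bar>y\<bar> \<le> 1/2" by auto
      have "y\<^sup>2 \<le> (1/2)\<^sup>2" using y(2) by (intro iffD1[OF abs_le_square_iff]) auto
      hence "\<bar>y\<^sup>2 + x\<bar> \<le> 1/2" 
        using False assms zero_le_power2[of y] by (simp add: power2_eq_square)
      thus ?case using y(1) by (intro exI[of _ "y\<^sup>2 + x"]) (simp add: critical_orbit_Suc)
    qed
    thus ?thesis by (auto simp: le_max_iff_disj)
  qed
  thus ?thesis using that by blast
qed

text \<open>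
  Since \<open>y\<^sup>2 + x - y = (y - 1/2)\<^sup>2 + (x - 1/4)\<close>, every step increases the orbit by at least \<open>x - 1/4\<close>.
\<close>

lemma critical_orbit_real_escapes:
  assumes "x > 1/4"
  shows "of_real x \<notin> mandelbrot"
proof
  assume "of_real x \<in> mandelbrot"
  hence B: "norm (critical_orbit n (of_real x)) \<le> 2" for n by (simp add: mandelbrot_eq)
  have "\<exists>y. critical_orbit n (of_real x) = of_real y \<and> y \<ge> real n * (x - 1/4)" for n
  proof (induction n)
    case 0
    then show ?case using assms by (intro exI[of _ x]) auto
  next
    case (Suc n)
    then obtain y where y: "critical_orbit n (of_real x) = of_real y" "y \<ge> real n * (x - 1/4)" by auto
    have "y\<^sup>2 + x = y + (x - 1/4) + (y - 1/2)\<^sup>2" by (simp add: power2_eq_square algebra_simps)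
    also have "\<dots> \<ge> y + (x - 1/4)" by simp
    finally have "y\<^sup>2 + x \<ge> y + (x - 1/4)" .
    with y(2) have "real n * (x - 1/4) + (x - 1/4) \<le> y\<^sup>2 + x"
      by (metis add_right_mono order_trans)
    hence "y\<^sup>2 + x \<ge> real (Suc n) * (x - 1/4)" by (simp add: distrib_right)
    thus ?case using y(1) by (intro exI[of _ "y\<^sup>2 + x"]) (simp add: critical_orbit_Suc)
  qed
  moreover obtain n where "2 < real n * (x - 1/4)"
    using reals_Archimedean3[of "x - 1/4"] assms by auto
  ultimately obtain y where "critical_orbit n (of_real x) = of_real y" "y > 2" by force
  thus False using B[of n] by simp
qed

theorem mandelbrot_real_slice: "mandelbrot \<inter> \<real> = complex_of_real ` {-2..1/4}"
proof (intro equalityI subsetI)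
  fix c assume c: "c \<in> mandelbrot \<inter> \<real>"
  then obtain x where x: "c = of_real x" by (auto elim: Reals_cases)
  have "norm (critical_orbit 0 c) \<le> 2" using c unfolding mandelbrot_eq by blast
  hence "-2 \<le> x" using x by simp
  moreover have "x \<le> 1/4" using critical_orbit_real_escapes[of x] c x by force
  ultimately show "c \<in> complex_of_real ` {-2..1/4}" using x by auto
next
  fix c assume "c \<in> complex_of_real ` {-2..1/4}"
  then obtain x where x: "c = of_real x" "-2 \<le> x" "x \<le> 1/4" by auto
  have "norm (critical_orbit n c) \<le> 2" for n
  proof -
    obtain y where "critical_orbit n (of_real x) = of_real y" "\<bar>y\<bar> \<le> max \<bar>x\<bar> (1/2)"
      using critical_orbit_real x by blast
    thus ?thesis using x by (auto simp: max_def split: if_splits)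
  qed
  thus "c \<in> mandelbrot \<inter> \<real>" using x by (simp add: mandelbrot_eq)
qed

lemma critical_orbit_holomorphic [holomorphic_intros]: "critical_orbit n holomorphic_on A"
proof (induction n)
  case 0
  have "critical_orbit 0 = (\<lambda>c. c)" by auto
  then show ?case by (simp add: holomorphic_on_ident)
next
  case (Suc n)
  have "critical_orbit (Suc n) = (\<lambda>c. (critical_orbit n c)\<^sup>2 + c)"
    by (simp add: critical_orbit_Suc fun_eq_iff)
  with Suc show ?case by (auto intro!: holomorphic_intros)
qed

lemma critical_orbit_continuous: "continuous_on A (critical_orbit n)"
  by (rule holomorphic_on_imp_continuous_on[OF critical_orbit_holomorphic])

lemma mandelbrot_subset_cball: "mandelbrot \<subseteq> cball 0 2"
proof
  fix c assume "c \<in> mandelbrot"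
  hence "norm (critical_orbit 0 c) \<le> 2" unfolding mandelbrot_eq by blast
  thus "c \<in> cball 0 2" by simp
qed

lemma closed_mandelbrot: "closed mandelbrot"
proof -
  have "closed {c. norm (critical_orbit n c) \<le> 2}" for n
    by (intro closed_Collect_le continuous_intros critical_orbit_continuous)
  hence "closed (\<Inter>n. {c. norm (critical_orbit n c) \<le> 2})" by auto
  thus ?thesis unfolding mandelbrot_eq by (simp add: Collect_all_eq)
qed

text \<open>
  If the critical orbit returns to 0, the critical point is periodic, so its orbit is bounded.
\<close>

lemma critical_orbit_nonzero:
  assumes "c \<notin> mandelbrot"
  shows "critical_orbit n c \<noteq> 0"
proof
  assume "critical_orbit n c = 0"
  moreover have "quad c 0 = c" by (simp add: quad_def)
  ultimately have per: "(quad c ^^ Suc n) 0 = 0"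
    by (simp add: critical_orbit_def funpow_swap1 del: funpow.simps(2)) (simp add: funpow_swap1)
  have "range (\<lambda>m. (quad c ^^ m) 0) \<subseteq> (\<lambda>m. (quad c ^^ m) 0) ` {..n}"
  proof
    fix z assume "z \<in> range (\<lambda>m. (quad c ^^ m) 0)"
    then obtain m where "z = (quad c ^^ m) 0" by auto
    hence "z = (quad c ^^ (m mod Suc n)) 0" using funpow_mod_eq[OF per, of m] by simp
    moreover have "m mod Suc n \<le> n" by (meson lessI less_Suc_eq_le mod_less_divisor zero_less_Suc)
    ultimately show "z \<in> (\<lambda>m. (quad c ^^ m) 0) ` {..n}" by blast
  qed
  hence "finite (range (\<lambda>m. (quad c ^^ m) 0))" by (rule finite_subset) auto
  hence "0 \<in> filled_julia c" by (simp add: filled_julia_def finite_imp_bounded)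
  hence "c \<in> filled_julia c" using quad_filled_julia_iff[of c 0] by (simp add: quad_def)
  with assms show False by (simp add: mandelbrot_eq critical_value_in_filled_julia_iff)
qed

lemma critical_orbit_asymptotics: "((\<lambda>c. critical_orbit n c / c ^ (2 ^ n)) \<longlongrightarrow> 1) at_infinity"
proof (induction n)
  case 0
  have "\<forall>\<^sub>F c in at_infinity. critical_orbit 0 c / c ^ (2 ^ 0) = (1::complex)"
    using eventually_not_equal_at_infinity[of 0] by eventually_elim auto
  thus ?case by (rule tendsto_eventually)
next
  case (Suc n)
  have "((\<lambda>c. (critical_orbit n c / c ^ (2 ^ n))\<^sup>2 + inverse c ^ (2 ^ Suc n - 1)) \<longlongrightarrow> 1\<^sup>2 + 0 ^ (2 ^ Suc n - 1))
          at_infinity"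
    by (intro tendsto_intros Suc tendsto_inverse_0)
  moreover have "2 ^ Suc n - 1 > (0::nat)"
    by (metis One_nat_def one_less_numeral_iff one_less_power semiring_norm(76) zero_less_Suc zero_less_diff)
  ultimately have "((\<lambda>c. (critical_orbit n c / c ^ (2 ^ n))\<^sup>2 + inverse c ^ (2 ^ Suc n - 1)) \<longlongrightarrow> 1) at_infinity"
    by (simp add: power_0_left)
  moreover have "\<forall>\<^sub>F c in at_infinity. (critical_orbit n c / c ^ (2 ^ n))\<^sup>2 + inverse c ^ (2 ^ Suc n - 1)
       = critical_orbit (Suc n) c / c ^ (2 ^ Suc n)"
    using eventually_not_equal_at_infinity[of 0]
  proof eventually_elim
    case (elim c)
    have "c * c ^ (2 ^ Suc n - 1) = c ^ (2 ^ Suc n)"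
      by (metis power_eq_if power_not_zero zero_neq_numeral)
    hence "inverse c ^ (2 ^ Suc n - 1) = c / c ^ (2 ^ Suc n)"
      using elim by (simp add: field_simps)
    moreover have "(critical_orbit n c / c ^ (2 ^ n))\<^sup>2 = (critical_orbit n c)\<^sup>2 / c ^ (2 ^ Suc n)"
      by (simp add: power_divide power_mult[symmetric] mult.commute)
    ultimately show ?case by (simp add: critical_orbit_Suc add_divide_distrib)
  qed
  ultimately show ?case by (rule Lim_transform_eventually)
qed

lemma critical_orbit_at_infinity: "filterlim (critical_orbit n) at_infinity at_infinity"
proof -
  have "filterlim (\<lambda>c::complex. c ^ (2 ^ n)) at_infinity at_infinity"
    by (rule filterlim_power_at_infinity) (auto intro: filterlim_ident)
  from tendsto_mult_filterlim_at_infinity[OF critical_orbit_asymptotics[of n] _ this]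
  have "filterlim (\<lambda>c. critical_orbit n c / c ^ 2 ^ n * c ^ 2 ^ n) at_infinity at_infinity" by simp
  moreover have "\<forall>\<^sub>F c in at_infinity. critical_orbit n c / c ^ 2 ^ n * c ^ 2 ^ n = critical_orbit n c"
    using eventually_not_equal_at_infinity[of 0] by eventually_elim auto
  ultimately show ?thesis by (rule filterlim_mono_eventually[OF _ order_refl order_refl])
qed

section \<open>Bounds for holomorphic functions\<close>

text \<open>
  A maximum principle that uses no information on the boundary behaviour of \<open>h\<close> itself: near \<open>K\<close> it is
  controlled by \<open>P\<close>, which is continuous across the boundary of \<open>K\<close>. It will be applied to
  \<open>h = P / \<Phi>^m\<close>, about whose behaviour at the Mandelbrot set only \<open>\<bar>\<Phi>\<bar> > 1\<close> is known.
\<close>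

lemma maximum_principle_exterior:
  fixes h P :: "complex \<Rightarrow> complex"
  assumes "closed K" "h holomorphic_on - K" "continuous_on UNIV P"
    and le: "\<And>z. z \<notin> K \<Longrightarrow> norm (h z) \<le> norm (P z)"
    and C: "\<And>z. z \<in> K \<Longrightarrow> norm (P z) \<le> C" "1 \<le> C"
    and inf: "(h \<longlongrightarrow> 1) at_infinity"
    and z: "z \<notin> K"
  shows "norm (h z) \<le> C"
proof (rule field_le_epsilon)
  fix e :: real assume e: "e > 0"
  have "\<forall>\<^sub>F c in at_infinity. dist (h c) 1 < e" using inf e by (rule tendstoD)
  then obtain R where R: "\<And>c. norm c \<ge> R \<Longrightarrow> dist (h c) 1 < e"
    by (auto simp: eventually_at_infinity)
  have far: "norm (h c) \<le> C + e" if "norm c \<ge> R" for c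
    using R[OF that] norm_triangle_ineq2[of "h c" 1] C(2) by (simp add: dist_norm)
  \<comment> \<open>The maximum principle is applied on the bounded region where the trivial bounds fail.\<close>
  define S where "S = ball 0 R \<inter> {c. norm (P c) > C + e}"
  have Popen: "open {c. norm (P c) > C + e}"
    by (intro open_Collect_less continuous_intros assms(3))
  have Pclosed: "closed {c. norm (P c) \<ge> C + e}"
    by (intro closed_Collect_le continuous_intros assms(3))
  have SK: "{c. norm (P c) \<ge> C + e} \<subseteq> - K" using C(1) e by force
  have clS: "closure S \<subseteq> {c. norm (P c) \<ge> C + e} \<inter> cball 0 R"
    by (rule closure_minimal) (auto simp: S_def intro!: Pclosed closed_Int)
  show "norm (h z) \<le> C + e"
  proof (cases "z \<in> S")
    case True
    show ?thesis
    proof (rule maximum_modulus_frontier[OF _ _ _ _ True])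
      show "h holomorphic_on interior S"
        using clS SK interior_subset closure_subset by (intro holomorphic_on_subset[OF assms(2)]) blast
      show "continuous_on (closure S) h"
        using clS SK by (intro continuous_on_subset[OF holomorphic_on_imp_continuous_on[OF assms(2)]]) blast
      show "bounded S" unfolding S_def by (intro bounded_Int) auto
      fix c assume c: "c \<in> frontier S"
      have "open S" unfolding S_def by (intro open_Int Popen) auto
      hence "c \<notin> S" "c \<in> closure S" using c by (auto simp: frontier_def interior_open)
      hence "c \<notin> K" "norm c \<ge> R \<or> norm (P c) \<le> C + e" using clS SK by (auto simp: S_def)
      thus "norm (h c) \<le> C + e" using far le order_trans by blast
    qed
  next
    case False
    hence "norm z \<ge> R \<or> norm (P z) \<le> C + e" by (auto simp: S_def)
    thus ?thesis using far le[OF z] by force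
  qed
qed

text \<open>
  A nonvanishing function has a logarithm, whose real part is bounded above. By the argument of Borel and
  Caratheodory (the Schwarz lemma after mapping the half-plane \<open>Re g < 2\<close> to the disc by
  \<open>g / (4 - g)\<close>) the logarithm is then bounded in modulus, which bounds the function from below.
\<close>

lemma nonvanishing_lower_bound:
  assumes f: "f holomorphic_on ball 0 1" and nz: "\<And>z. norm z < 1 \<Longrightarrow> f z \<noteq> 0"
    and f0: "f 0 = 1" and le: "\<And>z. norm z < 1 \<Longrightarrow> norm (f z) \<le> 2" and z: "norm z < 1"
  shows "norm (f z) \<ge> exp (- (4 * norm z / (1 - norm z)))"
proof -
  obtain g0 where g0: "g0 holomorphic_on ball 0 1" "\<And>z. z \<in> ball 0 1 \<Longrightarrow> f z = exp (g0 z)"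
    using contractible_imp_holomorphic_log[OF f] nz by (metis convex_ball convex_imp_contractible mem_ball_0)
  define g where "g z = g0 z - g0 0" for z
  have g: "g holomorphic_on ball 0 1" unfolding g_def by (intro holomorphic_intros g0)
  have "exp (g0 0) = 1" using g0(2)[of 0] f0 by simp
  hence fg: "f z = exp (g z)" if "norm z < 1" for z
    using g0(2)[of z] that by (simp add: g_def exp_diff)
  have Re: "Re (g z) < 2" if "norm z < 1" for z
  proof -
    have "exp (Re (g z)) \<le> 2" using le[OF that] fg[OF that] by (simp add: norm_exp_eq_Re)
    also have "2 < exp (2::real)" using exp_ge_add_one_self[of 2] by linarith
    finally show ?thesis by simp
  qed
  have lt: "norm (g z) < norm (4 - g z)" if "norm z < 1" for z
  proof (rule power2_less_imp_less)
    show "norm (g z) ^ 2 < norm (4 - g z) ^ 2"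
      using Re[OF that] unfolding cmod_power2 by (simp add: power2_eq_square algebra_simps)
  qed simp
  hence ne: "g z \<noteq> 4" if "norm z < 1" for z using that by force
  define \<phi> where "\<phi> z = g z / (4 - g z)" for z
  have "norm (\<phi> z) \<le> norm z"
  proof (rule Schwarz_Lemma(1)[OF _ _ _ z])
    show "\<phi> holomorphic_on ball 0 1"
      unfolding \<phi>_def using ne by (intro holomorphic_intros g) auto
    show "\<phi> 0 = 0" by (simp add: \<phi>_def g_def)
    show "norm (\<phi> w) < 1" if "norm w < 1" for w
      using lt[OF that] ne[OF that] by (simp add: \<phi>_def norm_divide)
  qed
  hence "norm (g z) \<le> norm z * norm (4 - g z)"
    using ne[OF z] by (simp add: \<phi>_def norm_divide divide_simps)
  also have "\<dots> \<le> norm z * (4 + norm (g z))"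
    using norm_triangle_ineq4[of 4 "g z"] by (intro mult_left_mono) auto
  finally have "norm (g z) \<le> 4 * norm z / (1 - norm z)"
    using z by (simp add: field_simps)
  hence "- (4 * norm z / (1 - norm z)) \<le> Re (g z)"
    using abs_Re_le_cmod[of "g z"] by linarith
  thus ?thesis using fg[OF z] by (simp add: norm_exp_eq_Re)
qed

section \<open>Radial limits and harmonic measure on the disc\<close>

text \<open>
  On the unit circle \<open>1 - cnj z * u = u * cnj (u - z)\<close>, so Cauchy's formula at \<open>z\<close> for the function
  \<open>f(u) (1 - \<bar>z\<bar>\<^sup>2) / (1 - cnj z * u)\<close>, which agrees with \<open>f\<close> at \<open>z\<close>, has the Poisson kernel as its weight.
\<close>

lemma poisson_formula:
  fixes f :: "complex \<Rightarrow> complex"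
  assumes f: "continuous_on (cball 0 1) f" "f holomorphic_on ball 0 1" and z: "norm z < 1"
  shows "((\<lambda>t. of_real ((1 - (norm z)\<^sup>2) / (norm (cis (2 * pi * t) - z))\<^sup>2) * f (cis (2 * pi * t)))
           has_integral f z) {0..1}"
proof -
  define F where "F u = f u * (1 - of_real ((norm z)\<^sup>2)) / (1 - cnj z * u)" for u
  have ne: "1 - cnj z * u \<noteq> 0" if "norm u \<le> 1" for u
  proof
    assume "1 - cnj z * u = 0"
    hence "norm z * norm u = 1" by (metis complex_mod_cnj eq_iff_diff_eq_0 norm_mult norm_one)
    moreover have "norm z * norm u \<le> norm z * 1" using that by (intro mult_left_mono) auto
    ultimately show False using z by simp
  qed
  have zz: "cnj z * z = of_real ((norm z)\<^sup>2)"
    by (metis complex_norm_square mult.commute)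
  have "1 - cnj z * z \<noteq> 0" using ne[of z] z by simp
  hence Fz: "F z = f z" unfolding F_def zz by simp
  have "((\<lambda>u. F u / (u - z)) has_contour_integral (2 * of_real pi * \<i> * F z)) (circlepath 0 1)"
  proof (rule Cauchy_integral_circlepath)
    show "continuous_on (cball 0 1) F" unfolding F_def
      using ne by (intro continuous_intros f) auto
    show "F holomorphic_on ball 0 1" unfolding F_def
      using ne by (intro holomorphic_intros f) auto
  qed (use z in auto)
  hence "((\<lambda>t. F (circlepath 0 1 t) / (circlepath 0 1 t - z) *
           vector_derivative (circlepath 0 1) (at t within {0..1})) has_integral (2 * of_real pi * \<i> * f z)) {0..1}"
    unfolding has_contour_integral_def Fz .
  hence h1: "((\<lambda>t. inverse (2 * of_real pi * \<i>) * (F (circlepath 0 1 t) / (circlepath 0 1 t - z) *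
           vector_derivative (circlepath 0 1) (at t within {0..1}))) has_integral
           inverse (2 * of_real pi * \<i>) * (2 * of_real pi * \<i> * f z)) {0..1}"
    by (rule has_integral_mult_right)
  moreover have kk: "2 * of_real pi * \<i> \<noteq> (0 :: complex)" by simp
  have "inverse k * (k * X) = X" if "k \<noteq> 0" for k X :: complex using that by simp
  from this[OF kk] have "inverse (2 * of_real pi * \<i>) * (2 * of_real pi * \<i> * f z) = f z" .
  moreover have "inverse (2 * of_real pi * \<i>) * (F (circlepath 0 1 t) / (circlepath 0 1 t - z) *
           vector_derivative (circlepath 0 1) (at t within {0..1})) =
        of_real ((1 - (norm z)\<^sup>2) / (norm (cis (2 * pi * t) - z))\<^sup>2) * f (cis (2 * pi * t))"
    if t: "t \<in> {0..1}" for t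
  proof -
    define e where "e = cis (2 * pi * t)"
    have c: "circlepath 0 1 t = e" by (simp add: circlepath e_def cis_conv_exp mult_ac)
    have v: "vector_derivative (circlepath 0 1) (at t within {0..1}) = 2 * of_real pi * \<i> * e"
      using t by (simp add: vector_derivative_circlepath01 e_def cis_conv_exp mult_ac)
    have ee: "e * cnj e = 1" "norm e = 1" by (simp_all add: e_def cis_cnj cis_mult)
    have "1 - cnj z * e = e * cnj (e - z)" using ee(1) by (simp add: algebra_simps)
    hence "F e = f e * (1 - of_real ((norm z)\<^sup>2)) / (e * cnj (e - z))" by (simp only: F_def)
    moreover have "inverse (2 * of_real pi * \<i>) * (F e / (e - z) * (2 * of_real pi * \<i> * e)) = F e / (e - z) * e"
    proof -
      have "inverse k * (X * (k * e)) = X * e" if "k \<noteq> 0" for k X :: complex using that by simp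
      from this[OF kk] show ?thesis .
    qed
    moreover have "f e * r / (e * d') / d * e = r / (d * d') * f e" for r d d'
      using ee(2) by (cases "e = 0") (auto simp: mult_ac)
    moreover have "of_real ((norm (e - z))\<^sup>2) = (e - z) * cnj (e - z)" by (rule complex_norm_square)
    ultimately have "inverse (2 * of_real pi * \<i>) * (F e / (e - z) * (2 * of_real pi * \<i> * e)) =
       of_real ((1 - (norm z)\<^sup>2) / (norm (e - z))\<^sup>2) * f e"
      by (simp only: of_real_divide of_real_diff of_real_1)
    thus ?thesis unfolding c v e_def .
  qed
  ultimately show ?thesis
    using has_integral_eq[OF _ h1] by simp
qed

lemma norm_cis_plus_sq:
  "(norm (cis (2 * pi * t) + of_real s))\<^sup>2 = (1 - s)\<^sup>2 + 4 * s * (sin (pi * (t - 1/2)))\<^sup>2"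
proof -
  have "(norm (cis (2 * pi * t) + of_real s))\<^sup>2 = (cos (2 * pi * t) + s)\<^sup>2 + (sin (2 * pi * t))\<^sup>2"
    by (simp add: cmod_power2)
  also have "\<dots> = 1 + s\<^sup>2 + 2 * s * cos (2 * pi * t)"
    using sin_cos_squared_add[of "2 * pi * t"] by (simp add: power2_eq_square algebra_simps)
  also have "cos (2 * pi * t) = - cos (2 * (pi * (t - 1/2)))"
    by (simp add: algebra_simps cos_diff)
  also have "cos (2 * (pi * (t - 1/2))) = 1 - 2 * (sin (pi * (t - 1/2)))\<^sup>2" by (rule cos_double_sin)
  finally show ?thesis by (simp add: power2_eq_square algebra_simps)
qed

lemma sin_pi_lower:
  assumes "\<bar>x\<bar> \<le> 1/2"
  shows "4 * x\<^sup>2 \<le> (sin (pi * x))\<^sup>2"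
proof -
  have cv: "convex_on {0..pi/2} (\<lambda>y. - sin y)"
  proof (rule f''_ge0_imp_convex)
    show "((\<lambda>y. - sin y) has_real_derivative - cos y) (at y)"
         "((\<lambda>y. - cos y) has_real_derivative sin y) (at y)" for y :: real
      by (auto intro!: derivative_eq_intros)
    show "sin y \<ge> 0" if "y \<in> {0..pi/2}" for y
      using that by (intro sin_ge_zero) auto
  qed simp
  have *: "2 * y \<le> sin (pi * y)" if "0 \<le> y" "y \<le> 1/2" for y :: real
    using convex_onD[OF cv, of "2 * y" 0 "pi/2"] that by (simp add: mult.commute)
  have "2 * \<bar>x\<bar> \<le> sin (pi * \<bar>x\<bar>)" using *[of "\<bar>x\<bar>"] assms by simp
  hence "(2 * \<bar>x\<bar>)\<^sup>2 \<le> (sin (pi * \<bar>x\<bar>))\<^sup>2" by (intro power_mono) auto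
  moreover have "(sin (pi * \<bar>x\<bar>))\<^sup>2 = (sin (pi * x))\<^sup>2" by (cases "x \<ge> 0") auto
  ultimately show ?thesis by (simp add: power2_eq_square)
qed

text \<open>
  The circle is parametrized such that \<open>t = 1/2\<close> is the angle of the point \<open>-s\<close>. With \<open>h = 1 - s\<close>, the
  three terms are the contributions of the good set \<open>G\<close>, where the kernel has total mass at most 1; of the
  angles at distance more than \<open>a\<close>, where the kernel is at most \<open>h / (4 (t - 1/2)\<^sup>2)\<close>; and of the part of
  the interval outside \<open>G\<close>, where the kernel is at most its peak value, of order \<open>2 / h\<close>.
\<close>

lemma poisson_bound:
  fixes f :: "complex \<Rightarrow> complex"
  assumes f: "continuous_on (cball 0 1) f" "f holomorphic_on ball 0 1"
    and C: "\<And>z. norm z \<le> 1 \<Longrightarrow> norm (f z) \<le> C"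
    and s: "1/2 \<le> s" "s < 1" and a: "0 < a" "a \<le> 1/2"
    and G: "G \<in> sets lebesgue" "G \<subseteq> {1/2 - a..1/2 + a}"
    and q: "0 \<le> q" "\<And>t. t \<in> G \<Longrightarrow> norm (f (cis (2 * pi * t))) \<le> q"
  shows "norm (f (- of_real s)) \<le> q + C * pi * (1 - s) / (2 * a)
           + 2 * C / (1 - s) * measure lebesgue ({1/2 - a..1/2 + a} - G)"
proof -
  define h where "h = 1 - s"
  define z :: complex where "z = - of_real s"
  define A where "A = {1/2 - a..1/2 + a} - G"
  have h: "0 < h" "h \<le> 1/2" using s by (auto simp: h_def)
  have z: "norm z = s" "norm z < 1" using s by (auto simp: z_def)
  have C0: "C \<ge> 0" using order_trans[OF norm_ge_zero C[of 0]] by simp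
  define K where "K t = (1 - s\<^sup>2) / (norm (cis (2 * pi * t) - z))\<^sup>2" for t
  have int: "((\<lambda>t. of_real (K t) * g (cis (2 * pi * t))) has_integral g z) {0..1}"
    if "continuous_on (cball 0 1) g" "g holomorphic_on ball 0 1" for g :: "complex \<Rightarrow> complex"
    using poisson_formula[OF that z(2)] by (simp add: K_def z(1))
  have "((\<lambda>t. complex_of_real (K t)) has_integral 1) {0..1}"
    using int[of "\<lambda>_. 1"] by simp
  from has_integral_Re[OF this] have K1: "(K has_integral 1) {0..1}" by simp
  have Knn: "K t \<ge> 0" for t
    using s by (auto simp: K_def power_le_one intro!: divide_nonneg_nonneg)
  have dist: "(norm (cis (2 * pi * t) - z))\<^sup>2 = h\<^sup>2 + 4 * s * (sin (pi * (t - 1/2)))\<^sup>2" for t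
    using norm_cis_plus_sq[of t s] by (simp add: z_def h_def)
  have hs: "1 - s\<^sup>2 \<le> 2 * h" "0 \<le> 1 - s\<^sup>2"
  proof -
    have "1 - s\<^sup>2 = h * (1 + s)" by (simp add: h_def power2_eq_square algebra_simps)
    also have "\<dots> \<le> h * 2" using h s by (intro mult_left_mono) auto
    finally show "1 - s\<^sup>2 \<le> 2 * h" by simp
    show "0 \<le> 1 - s\<^sup>2" using s by (simp add: power_le_one)
  qed
  have Kpeak: "K t \<le> 2 / h" for t
  proof -
    have "K t \<le> (2 * h) / h\<^sup>2"
      unfolding K_def dist using hs h s by (intro frac_le) auto
    thus ?thesis using h by (simp add: power2_eq_square)
  qed
  \<comment> \<open>A majorant of the tail of the kernel which has an elementary primitive on the whole circle.\<close>
  define B where "B t = h / 2 * (1 / ((t - 1/2)\<^sup>2 + a\<^sup>2))" for t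
  have Bnn: "B t \<ge> 0" for t using h by (auto simp: B_def intro!: mult_nonneg_nonneg)
  have Ktail: "K t \<le> B t" if "t \<in> {0..1}" "t \<notin> {1/2 - a..1/2 + a}" for t
  proof -
    define x where "x = t - 1/2"
    have x: "\<bar>x\<bar> \<le> 1/2" "\<bar>x\<bar> > a" using that unfolding x_def by (auto simp: abs_if split: if_splits)
    have "8 * x\<^sup>2 \<le> 4 * s * (4 * x\<^sup>2)" using s mult_right_mono[of "1/2" s "16 * x\<^sup>2"] by simp
    also have "\<dots> \<le> 4 * s * (sin (pi * x))\<^sup>2"
      using sin_pi_lower[OF x(1)] s by (intro mult_left_mono) auto
    finally have 1: "8 * x\<^sup>2 \<le> h\<^sup>2 + 4 * s * (sin (pi * x))\<^sup>2" using zero_le_power2[of h] by linarith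
    have "a\<^sup>2 \<le> x\<^sup>2" using x a by (intro iffD1[OF abs_le_square_iff]) auto
    hence 2: "4 * (x\<^sup>2 + a\<^sup>2) \<le> 8 * x\<^sup>2" by simp
    have "x\<^sup>2 + a\<^sup>2 > 0" using a by (intro add_nonneg_pos) auto
    hence "K t \<le> (2 * h) / (4 * (x\<^sup>2 + a\<^sup>2))"
      unfolding K_def dist x_def[symmetric] using hs h 1 2 by (intro frac_le) auto
    also have "2 * h / (4 * Y) = h / 2 * (1 / Y)" for Y by simp
    also have "h / 2 * (1 / (x\<^sup>2 + a\<^sup>2)) = B t" by (simp only: B_def x_def)
    finally show ?thesis .
  qed
  have BI: "(B has_integral (h / 2 * (arctan ((1 - 1/2) / a) / a - arctan ((0 - 1/2) / a) / a))) {0..1}"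
    unfolding B_def
  proof (intro has_integral_mult_right fundamental_theorem_of_calculus)
    fix t :: real
    have "((\<lambda>t. arctan ((t - 1/2) / a) / a) has_real_derivative 1 / ((t - 1/2)\<^sup>2 + a\<^sup>2)) (at t within {0..1})"
    proof -
      have "((\<lambda>t. arctan ((t - 1/2) / a) / a) has_real_derivative inverse (1 + ((t - 1/2) / a)\<^sup>2) * (1 / a) / a) (at t within {0..1})"
        using a by (auto intro!: derivative_eq_intros)
      also have "inverse (1 + ((t - 1/2) / a)\<^sup>2) * (1 / a) / a = 1 / ((t - 1/2)\<^sup>2 + a\<^sup>2)"
      proof -
        have "1 + ((t - 1/2) / a)\<^sup>2 = ((t - 1/2)\<^sup>2 + a\<^sup>2) / a\<^sup>2" using a by (simp add: power_divide field_simps)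
        thus ?thesis using a by (simp add: power2_eq_square)
      qed
      finally show ?thesis .
    qed
    thus "((\<lambda>t. arctan ((t - 1/2) / a) / a) has_vector_derivative 1 / ((t - 1/2)\<^sup>2 + a\<^sup>2)) (at t within {0..1})"
      by (simp add: has_real_derivative_iff_has_vector_derivative)
  qed simp
  have Bval: "h / 2 * (arctan ((1 - 1/2) / a) / a - arctan ((0 - 1/2) / a) / a) \<le> pi * h / (2 * a)"
  proof -
    have "arctan ((1 - 1/2) / a) / a - arctan ((0 - 1/2) / a) / a \<le> pi / a"
      unfolding diff_divide_distrib[symmetric]
      using arctan_bounded[of "(1 - 1/2) / a"] arctan_bounded[of "(0 - 1/2) / a"] a
      by (intro divide_right_mono) linarith+
    from mult_left_mono[OF this, of "h / 2"] show ?thesis using h by (simp add: mult_ac)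
  qed
  have A: "A \<in> lmeasurable" "A \<subseteq> {0..1}"
    using G a unfolding A_def by (auto intro: fmeasurable_Diff)
  have AI: "(indicat_real A has_integral measure lebesgue A) {0..1}"
  proof -
    have "(indicat_real A has_integral measure lebesgue A) UNIV"
      using A(1) lmeasurable_iff_indicator_has_integral by blast
    moreover have "indicat_real A = (\<lambda>x. if x \<in> {0..1} then indicat_real A x else 0)"
      using A(2) by (auto simp: indicator_def fun_eq_iff)
    ultimately show ?thesis by (metis has_integral_restrict_UNIV)
  qed
  define g where "g t = q * K t + C * B t + C * (2 / h) * indicat_real A t" for t
  have gI: "(g has_integral (q * 1 + C * (h / 2 * (arctan ((1 - 1/2) / a) / a - arctan ((0 - 1/2) / a) / a))
       + C * (2 / h) * measure lebesgue A)) {0..1}"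
    unfolding g_def by (intro has_integral_add has_integral_mult_right K1 BI AI)
  have le: "norm (of_real (K t) * f (cis (2 * pi * t))) \<le> g t" if t: "t \<in> {0..1}" for t
  proof -
    have Cf: "norm (f (cis (2 * pi * t))) \<le> C" by (intro C) simp
    have n: "norm (of_real (K t) * f (cis (2 * pi * t))) = K t * norm (f (cis (2 * pi * t)))"
      using Knn by (simp add: norm_mult)
    consider "t \<in> G" | "t \<in> A" | "t \<notin> {1/2 - a..1/2 + a}" using G(2) unfolding A_def by blast
    thus ?thesis
    proof cases
      case 1
      have "K t * norm (f (cis (2 * pi * t))) \<le> K t * q" using q(2)[OF 1] Knn by (intro mult_left_mono)
      moreover have "0 \<le> C * B t" "0 \<le> C * (2 / h) * indicat_real A t" using C0 Bnn h by auto
      ultimately show ?thesis unfolding n g_def by (simp add: mult.commute)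
    next
      case 2
      have "K t * norm (f (cis (2 * pi * t))) \<le> 2 / h * C" using Cf Knn Kpeak h by (intro mult_mono) auto
      moreover have "0 \<le> C * B t" "0 \<le> q * K t" using C0 Bnn q Knn by auto
      ultimately show ?thesis using 2 unfolding n g_def by (simp add: mult.commute)
    next
      case 3
      have "K t * norm (f (cis (2 * pi * t))) \<le> B t * C" using Cf Ktail[OF t 3] Knn Bnn by (intro mult_mono) auto
      moreover have "0 \<le> q * K t" "0 \<le> C * (2 / h) * indicat_real A t" using C0 q Knn h by auto
      ultimately show ?thesis unfolding n g_def by (simp add: mult.commute)
    qed
  qed
  have "norm (f z) \<le> q * 1 + C * (h / 2 * (arctan ((1 - 1/2) / a) / a - arctan ((0 - 1/2) / a) / a))
       + C * (2 / h) * measure lebesgue A"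
    using integral_norm_bound_integral[OF has_integral_integrable[OF int[OF f]] has_integral_integrable[OF gI] le]
      int[OF f] gI by (simp add: integral_unique)
  also have "\<dots> \<le> q + C * (pi * h / (2 * a)) + C * (2 / h) * measure lebesgue A"
    using mult_left_mono[OF Bval C0] by simp
  finally show ?thesis by (simp add: z_def A_def h_def mult_ac)
qed

lemma eventually_at_left_1_iff:
  fixes P :: "real \<Rightarrow> bool"
  shows "(\<forall>\<^sub>F r in at_left 1. P r) \<longleftrightarrow> (\<exists>N::nat. \<forall>r\<in>{1 - 1 / real (N + 2)..<1}. P r)"
proof
  assume "\<forall>\<^sub>F r in at_left 1. P r"
  then obtain b where b: "b < 1" "\<And>r. b < r \<Longrightarrow> r < 1 \<Longrightarrow> P r"
    unfolding eventually_at_left_field by blast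
  obtain N :: nat where N: "1 / (1 - b) < real N" using reals_Archimedean2 by blast
  have "1 / real (N + 2) < 1 - b"
  proof -
    have "1 < real N * (1 - b)" using N b(1) by (simp add: field_simps)
    also have "\<dots> \<le> real (N + 2) * (1 - b)" using b(1) by (intro mult_right_mono) auto
    finally show ?thesis by (simp add: field_simps)
  qed
  hence "\<forall>r\<in>{1 - 1 / real (N + 2)..<1}. P r" using b(2) by auto
  thus "\<exists>N::nat. \<forall>r\<in>{1 - 1 / real (N + 2)..<1}. P r" ..
next
  assume "\<exists>N::nat. \<forall>r\<in>{1 - 1 / real (N + 2)..<1}. P r"
  then obtain N :: nat where N: "\<forall>r\<in>{1 - 1 / real (N + 2)..<1}. P r" ..
  show "\<forall>\<^sub>F r in at_left 1. P r"
    unfolding eventually_at_left_field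
    by (rule exI[of _ "1 - 1 / real (N + 2)"]) (use N in auto)
qed

text \<open>
  These sets are closed and increase with \<open>N\<close>. Their union is the set of angles at which \<open>\<bar>f\<bar> \<le> q\<close> near the
  end of the radius, which is thereby measurable.
\<close>

definition radially_small :: "(complex \<Rightarrow> complex) \<Rightarrow> real \<Rightarrow> nat \<Rightarrow> real set" where
  "radially_small f q N = {t. \<forall>r\<in>{1 - 1 / real (N + 2)..<1}. norm (f (of_real r * cis (2 * pi * t))) \<le> q}"

lemma closed_radially_small:
  assumes "continuous_on (ball 0 1) f"
  shows "closed (radially_small f q N)"
proof -
  have "closed {t. norm (f (of_real r * cis (2 * pi * t))) \<le> q}"
    if r: "r \<in> {1 - 1 / real (N + 2)..<1}" for r
  proof -
    have "1 / real (N + 2) \<le> 1" by simp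
    with r have "0 \<le> r" "r < 1" unfolding atLeastLessThan_iff by linarith+
    hence "continuous_on UNIV (\<lambda>t. f (of_real r * cis (2 * pi * t)))"
      by (intro continuous_on_compose2[OF assms]) (auto intro!: continuous_intros simp: norm_mult)
    thus ?thesis by (intro closed_Collect_le continuous_intros)
  qed
  hence "closed (\<Inter>r\<in>{1 - 1 / real (N + 2)..<1}. {t. norm (f (of_real r * cis (2 * pi * t))) \<le> q})"
    by auto
  also have "(\<Inter>r\<in>{1 - 1 / real (N + 2)..<1}. {t. norm (f (of_real r * cis (2 * pi * t))) \<le> q})
     = radially_small f q N"
    by (auto simp: radially_small_def)
  finally show ?thesis .
qed

lemma radially_small_mono: "N \<le> M \<Longrightarrow> radially_small f q N \<subseteq> radially_small f q M"
proof -
  assume "N \<le> M"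
  hence "1 / real (M + 2) \<le> 1 / real (N + 2)" by (intro frac_le) auto
  thus ?thesis by (force simp: radially_small_def)
qed

lemma UN_radially_small:
  "(\<Union>N. radially_small f q N) = {t. \<forall>\<^sub>F r in at_left 1. norm (f (of_real r * cis (2 * pi * t))) \<le> q}"
  by (auto simp: radially_small_def eventually_at_left_1_iff)

text \<open>
  The previous bound is applied to the dilations \<open>f(\<rho> z)\<close>, with the sets \<open>radially_small\<close> in the role of
  \<open>G\<close>. As \<open>\<rho>\<close> tends to 1 they exhaust \<open>G\<close> up to measure 0, by continuity of the measure.
\<close>

lemma radial_bound_centered:
  fixes f :: "complex \<Rightarrow> complex"
  assumes f: "f holomorphic_on ball 0 1"
    and C: "\<And>z. norm z < 1 \<Longrightarrow> norm (f z) \<le> C"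
    and s: "1/2 \<le> s" "s < 1" and a: "0 < a" "a \<le> 1/2"
    and G: "G \<in> sets lebesgue" "G \<subseteq> {1/2 - a..1/2 + a}" and q: "0 \<le> q"
    and Gq: "\<And>t. t \<in> G \<Longrightarrow> \<forall>\<^sub>F r in at_left 1. norm (f (of_real r * cis (2 * pi * t))) \<le> q"
  shows "norm (f (- of_real s)) \<le> q + C * pi * (1 - s) / (2 * a)
           + 2 * C / (1 - s) * measure lebesgue ({1/2 - a..1/2 + a} - G)"
proof -
  let ?J = "{1/2 - a..1/2 + a}"
  have cont: "continuous_on (ball 0 1) f" by (rule holomorphic_on_imp_continuous_on[OF f])
  have C0: "C \<ge> 0" using order_trans[OF norm_ge_zero C[of 0]] by simp
  define R where "R N = radially_small f q N" for N
  have R: "closed (R N)" for N unfolding R_def by (rule closed_radially_small[OF cont])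
  hence Rs: "R N \<in> sets lebesgue" for N by (simp add: borel_closed)
  define \<rho> where "\<rho> N = 1 - 1 / real (N + 2)" for N
  have \<rho>: "0 < \<rho> N" "\<rho> N < 1" for N by (auto simp: \<rho>_def)
  have bound: "norm (f (of_real (\<rho> N) * - of_real s)) \<le> q + C * pi * (1 - s) / (2 * a)
           + 2 * C / (1 - s) * measure lebesgue (?J - R N)" for N
  proof -
    have "norm ((\<lambda>z. f (of_real (\<rho> N) * z)) (- of_real s)) \<le> q + C * pi * (1 - s) / (2 * a)
           + 2 * C / (1 - s) * measure lebesgue (?J - (?J \<inter> R N))"
    proof (rule poisson_bound[OF _ _ _ s a _ _ q])
      have lt: "norm (of_real (\<rho> N) * z) < 1" if "norm z \<le> 1" for z :: complex
      proof -
        have "\<rho> N * norm z \<le> \<rho> N * 1" using that \<rho>[of N] by (intro mult_left_mono) auto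
        moreover have "norm (of_real (\<rho> N) * z) = \<rho> N * norm z"
          using \<rho>[of N] by (simp add: norm_mult)
        ultimately show ?thesis using \<rho>[of N] by linarith
      qed
      show "continuous_on (cball 0 1) (\<lambda>z. f (of_real (\<rho> N) * z))"
        using lt by (intro continuous_on_compose2[OF cont]) (auto intro!: continuous_intros)
      show "(\<lambda>z. f (of_real (\<rho> N) * z)) holomorphic_on ball 0 1"
        using lt by (intro holomorphic_on_compose_gen[OF _ f, unfolded o_def]) (auto intro!: holomorphic_intros)
      show "norm (f (of_real (\<rho> N) * z)) \<le> C" if "norm z \<le> 1" for z
        by (intro C lt that)
      show "norm (f (of_real (\<rho> N) * cis (2 * pi * t))) \<le> q" if "t \<in> ?J \<inter> R N" for t
      proof -
        have "\<rho> N \<in> {1 - 1 / real (N + 2)..<1}" using \<rho>[of N] unfolding \<rho>_def by simp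
        thus ?thesis using that unfolding R_def radially_small_def by blast
      qed
    qed (use Rs in auto)
    moreover have "?J - (?J \<inter> R N) = ?J - R N" by blast
    ultimately show ?thesis by simp
  qed
  have "(\<lambda>N. measure lebesgue (?J - R N)) \<longlonglongrightarrow> measure lebesgue (\<Inter>N. ?J - R N)"
  proof (rule Lim_measure_decseq)
    show "range (\<lambda>N. ?J - R N) \<subseteq> sets lebesgue" using Rs by auto
    show "decseq (\<lambda>N. ?J - R N)"
      unfolding decseq_def R_def using radially_small_mono by blast
    show "emeasure lebesgue (?J - R N) \<noteq> \<infinity>" for N
    proof -
      have "?J - R N \<in> lmeasurable" using Rs by (intro fmeasurable_Diff) auto
      thus ?thesis unfolding infinity_ennreal_def by (rule fmeasurableD2)
    qed
  qed
  hence lim1: "(\<lambda>N. q + C * pi * (1 - s) / (2 * a) + 2 * C / (1 - s) * measure lebesgue (?J - R N)) \<longlonglongrightarrow>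
      q + C * pi * (1 - s) / (2 * a) + 2 * C / (1 - s) * measure lebesgue (\<Inter>N. ?J - R N)"
    by (intro tendsto_intros)
  have "\<rho> \<longlonglongrightarrow> 1 - 0" unfolding \<rho>_def
    using LIMSEQ_ignore_initial_segment[OF lim_1_over_n, of 2] by (intro tendsto_intros) simp
  hence "(\<lambda>N. of_real (\<rho> N) * - of_real s :: complex) \<longlonglongrightarrow> of_real (1 - 0) * - of_real s"
    by (intro tendsto_intros)
  hence "(\<lambda>N. of_real (\<rho> N) * - of_real s :: complex) \<longlonglongrightarrow> - of_real s" by simp
  moreover have "isCont f (- of_real s)"
    using cont s by (auto simp: continuous_on_eq_continuous_at)
  ultimately have "(\<lambda>N. f (of_real (\<rho> N) * - of_real s)) \<longlonglongrightarrow> f (- of_real s)"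
    by (rule isCont_tendsto_compose[rotated])
  from LIMSEQ_le[OF tendsto_norm[OF this] lim1]
  have "norm (f (- of_real s)) \<le> q + C * pi * (1 - s) / (2 * a) + 2 * C / (1 - s) * measure lebesgue (\<Inter>N. ?J - R N)"
    using bound by blast
  also have "measure lebesgue (\<Inter>N. ?J - R N) \<le> measure lebesgue (?J - G)"
  proof (rule measure_mono_fmeasurable)
    show "(\<Inter>N. ?J - R N) \<subseteq> ?J - G" using Gq UN_radially_small[of f q] by (auto simp: R_def)
    show "(\<Inter>N. ?J - R N) \<in> sets lebesgue" using Rs by auto
    show "?J - G \<in> lmeasurable" using G by (intro fmeasurable_Diff) auto
  qed
  hence "2 * C / (1 - s) * measure lebesgue (\<Inter>N. ?J - R N) \<le> 2 * C / (1 - s) * measure lebesgue (?J - G)"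
    using C0 s by (intro mult_left_mono) auto
  finally show ?thesis by simp
qed

text \<open>
  The centered bound for a rotated function: the interval of angles is moved to be centered at \<open>1/2\<close>.
\<close>

lemma radial_bound:
  fixes f :: "complex \<Rightarrow> complex"
  assumes f: "f holomorphic_on ball 0 1"
    and C: "\<And>z. norm z < 1 \<Longrightarrow> norm (f z) \<le> C"
    and s: "1/2 \<le> s" "s < 1" and uv: "u < v" "v \<le> u + 1"
    and L: "L \<in> sets lebesgue" and q: "0 \<le> q"
    and Lq: "\<And>t. t \<in> L \<Longrightarrow> \<forall>\<^sub>F r in at_left 1. norm (f (of_real r * cis (2 * pi * t))) \<le> q"
  shows "norm (f (of_real s * cis (2 * pi * ((u + v) / 2)))) \<le> q + C * pi * (1 - s) / (v - u)
           + 2 * C / (1 - s) * measure lebesgue ({u..v} - L)"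
proof -
  define d where "d = (u + v) / 2 - 1/2"
  define a where "a = (v - u) / 2"
  define b where "b = cis (2 * pi * d)"
  have b: "norm b = 1" by (simp add: b_def)
  have rot: "b * cis (2 * pi * t) = cis (2 * pi * (d + t))" for t
    by (simp add: b_def cis_mult algebra_simps)
  have J: "(+) d ` {1/2 - a..1/2 + a} = {u..v}"
    unfolding image_add_atLeastAtMost by (simp add: d_def a_def field_simps)
  define G where "G = {1/2 - a..1/2 + a} \<inter> (+) (- d) ` L"
  have "norm ((\<lambda>z. f (b * z)) (- of_real s)) \<le> q + C * pi * (1 - s) / (2 * a)
           + 2 * C / (1 - s) * measure lebesgue ({1/2 - a..1/2 + a} - G)"
  proof (rule radial_bound_centered[OF _ _ s _ _ _ _ q])
    show "(\<lambda>z. f (b * z)) holomorphic_on ball 0 1"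
      by (intro holomorphic_on_compose_gen[OF _ f, unfolded o_def])
        (auto intro!: holomorphic_intros simp: norm_mult b)
    show "norm (f (b * z)) \<le> C" if "norm z < 1" for z using that by (intro C) (simp add: norm_mult b)
    show "G \<in> sets lebesgue" unfolding G_def
      using L by (intro sets.Int lebesgue_sets_translation) auto
    show "\<forall>\<^sub>F r in at_left 1. norm (f (b * (of_real r * cis (2 * pi * t)))) \<le> q" if "t \<in> G" for t
    proof -
      have "d + t \<in> L" using that by (auto simp: G_def)
      moreover have "b * (of_real r * cis (2 * pi * t)) = of_real r * cis (2 * pi * (d + t))" for r
        unfolding rot[of t, symmetric] by (rule mult.left_commute)
      ultimately show ?thesis using Lq[of "d + t"] by (simp only:)
    qed
  qed (use uv in \<open>auto simp: a_def G_def\<close>)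
  moreover have "b * (- of_real s) = of_real s * cis (2 * pi * ((u + v) / 2))"
  proof -
    have "cis (2 * pi * (1/2)) = -1" by simp
    hence "b * (- of_real s) = of_real s * (b * cis (2 * pi * (1/2)))" by simp
    also have "\<dots> = of_real s * cis (2 * pi * (d + 1/2))" unfolding rot ..
    finally show ?thesis by (simp add: d_def)
  qed
  moreover have "measure lebesgue ({1/2 - a..1/2 + a} - G) = measure lebesgue ({u..v} - L)"
  proof -
    have "(+) d ` ({1/2 - a..1/2 + a} - G) = {u..v} - L"
    proof -
      have "{1/2 - a..1/2 + a} - G = {1/2 - a..1/2 + a} - (+) (- d) ` L" unfolding G_def by blast
      hence "(+) d ` ({1/2 - a..1/2 + a} - G) = (+) d ` {1/2 - a..1/2 + a} - (+) d ` (+) (- d) ` L"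
        by (simp add: image_set_diff)
      moreover have "(+) d ` (+) (- d) ` L = L" by (simp add: image_image)
      ultimately show ?thesis unfolding J by simp
    qed
    thus ?thesis by (metis measure_translation)
  qed
  moreover have "2 * a = v - u" by (simp add: a_def)
  ultimately show ?thesis by simp
qed

text \<open>
  A weak form of Lebesgue's density theorem that provides an interval of exactly dyadic length: cover \<open>L\<close>
  by nonoverlapping dyadic intervals inside an open set that is only slightly larger than \<open>L\<close>. If the
  complement of \<open>L\<close> had a large proportion in each of them, the open set would be too large.
\<close>

lemma dense_dyadic_interval:
  fixes L :: "real set"
  assumes L: "L \<in> sets lebesgue" "L \<subseteq> {0..1}" "L \<notin> null_sets lebesgue" and e: "0 < e"
  obtains u v j where "u < v" "v - u = 1 / 2 ^ (j::nat)" "measure lebesgue ({u..v} - L) \<le> e * (v - u)"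
proof -
  have lm: "L \<in> lmeasurable" using L(1,2) by (intro bounded_set_imp_lmeasurable) (auto intro: bounded_subset[OF bounded_closed_interval])
  define m where "m = measure lebesgue L"
  have em: "emeasure lebesgue L = ennreal m"
    using lm by (simp add: m_def emeasure_eq_measure2)
  have m: "m > 0" using L(1,3) em by (auto simp: null_sets_def m_def zero_less_measure_iff)
  obtain T where T: "open T" "L \<subseteq> T" "T - L \<in> lmeasurable" "emeasure lebesgue (T - L) < ennreal (e * m)"
    using sets_lebesgue_outer_open[OF L(1), of "e * m"] m e by auto
  define g where "g x = (if x \<in> T then T else UNIV)" for x
  have "gauge g" using T(1) by (auto simp: gauge_def g_def)
  have "L \<subseteq> cbox 0 1" "box (0::real) 1 \<noteq> {}" using L(2) by auto
  from covering_lemma[OF this \<open>gauge g\<close>] obtain D where D: "countable D" "\<Union>D \<subseteq> cbox 0 1"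
    "\<And>K. K \<in> D \<Longrightarrow> interior K \<noteq> {} \<and> (\<exists>c d. K = cbox c d)"
    "pairwise (\<lambda>A B. interior A \<inter> interior B = {}) D"
    "\<And>K. K \<in> D \<Longrightarrow> \<exists>x \<in> L \<inter> K. K \<subseteq> g x"
    "\<And>u v. cbox u v \<in> D \<Longrightarrow> \<exists>n. \<forall>i \<in> Basis. v \<bullet> i - u \<bullet> i = (1 \<bullet> i - 0 \<bullet> i) / 2^n"
    "L \<subseteq> \<Union>D" by blast
  have "\<exists>K\<in>D. emeasure lebesgue (interior K - L) \<le> ennreal e * emeasure lebesgue (interior K)"
  proof (rule ccontr)
    assume "\<not> ?thesis"
    hence *: "ennreal e * emeasure lebesgue (interior K) \<le> emeasure lebesgue (interior K - L)" if "K \<in> D" for K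
      using that by force
    have disj: "disjoint_family_on interior D" "disjoint_family_on (\<lambda>K. interior K - L) D"
      using D(4) by (auto simp: disjoint_family_on_def pairwise_def)
    have null: "(\<Union>K\<in>D. K - interior K) \<in> null_sets lebesgue"
    proof (rule null_sets_UN'[OF D(1)])
      fix K assume "K \<in> D"
      then obtain c d where "K = cbox c d" using D(3) by blast
      hence "K - interior K \<subseteq> {c, d}" by auto
      hence "finite (K - interior K)" by (rule finite_subset) auto
      thus "K - interior K \<in> null_sets lebesgue" by (simp add: negligible_finite negligible_iff_null_sets[symmetric])
    qed
    have iS: "interior K \<in> sets lebesgue" for K :: "real set" by (simp add: borel_open)
    have IS: "(\<Union>K\<in>D. interior K) \<in> sets lebesgue"
      using iS by (intro sets.countable_UN' D(1)) blast
    have "L \<subseteq> (\<Union>K\<in>D. interior K) \<union> (\<Union>K\<in>D. K - interior K)" using D(7) by blast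
    hence "emeasure lebesgue L \<le> emeasure lebesgue ((\<Union>K\<in>D. interior K) \<union> (\<Union>K\<in>D. K - interior K))"
      using IS null by (intro emeasure_mono sets.Un) auto
    also have "\<dots> = emeasure lebesgue (\<Union>K\<in>D. interior K)"
      by (rule emeasure_Un_null_set[OF IS null])
    finally have "ennreal e * emeasure lebesgue L \<le> ennreal e * emeasure lebesgue (\<Union>K\<in>D. interior K)"
      by (rule mult_left_mono) simp
    also have "emeasure lebesgue (\<Union>K\<in>D. interior K) = (\<integral>\<^sup>+K. emeasure lebesgue (interior K) \<partial>count_space D)"
      by (rule emeasure_UN_countable[OF iS D(1) disj(1)])
    also have "ennreal e * \<dots> = (\<integral>\<^sup>+K. ennreal e * emeasure lebesgue (interior K) \<partial>count_space D)"
      by (rule nn_integral_cmult[symmetric]) simp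
    also have "\<dots> \<le> (\<integral>\<^sup>+K. emeasure lebesgue (interior K - L) \<partial>count_space D)"
      using * by (intro nn_integral_mono) simp
    also have "\<dots> = emeasure lebesgue (\<Union>K\<in>D. interior K - L)"
      by (rule emeasure_UN_countable[OF _ D(1) disj(2), symmetric]) (intro sets.Diff iS L(1))
    also have "\<dots> \<le> emeasure lebesgue (T - L)"
    proof (rule emeasure_mono)
      have "K \<subseteq> T" if K: "K \<in> D" for K
      proof -
        obtain x where "x \<in> L" "K \<subseteq> g x" using D(5)[OF K] by blast
        thus ?thesis using T(2) by (auto simp: g_def split: if_splits)
      qed
      thus "(\<Union>K\<in>D. interior K - L) \<subseteq> T - L" using interior_subset by blast
    qed (use T(3) in auto)
    also have "\<dots> < ennreal (e * m)" by (rule T(4))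
    finally show False using em e m by (simp add: ennreal_mult[symmetric])
  qed
  then obtain K where K: "K \<in> D" "emeasure lebesgue (interior K - L) \<le> ennreal e * emeasure lebesgue (interior K)"
    by blast
  then obtain u v where uv: "K = cbox u v" "interior K \<noteq> {}" using D(3) by blast
  have "u < v" using uv by (auto simp: interior_cbox)
  obtain j where j: "v - u = 1 / 2 ^ j" using D(6) K(1) uv(1) by auto
  have "emeasure lebesgue ({u<..<v} - L) \<le> ennreal (e * (v - u))"
    using K(2) uv(1) \<open>u < v\<close> e by (simp add: ennreal_mult)
  moreover have "{u<..<v} - L \<in> lmeasurable" using L(1) by (intro fmeasurable_Diff) auto
  ultimately have "measure lebesgue ({u<..<v} - L) \<le> e * (v - u)"
    using \<open>u < v\<close> e by (simp add: emeasure_eq_measure2)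
  moreover have "measure lebesgue ({u..v} - L) = measure lebesgue ({u<..<v} - L)"
  proof (rule measure_negligible_symdiff)
    show "{u<..<v} - L \<in> lmeasurable" using L(1) by (intro fmeasurable_Diff) auto
    show "negligible (({u<..<v} - L - ({u..v} - L)) \<union> ({u..v} - L - ({u<..<v} - L)))"
      by (rule negligible_subset[of "{u, v}"]) auto
  qed
  ultimately show ?thesis using that[of u v j] \<open>u < v\<close> j by simp
qed

section \<open>The exterior of the Mandelbrot set\<close>

locale exterior_uniformization =
  fixes \<Phi> :: "complex \<Rightarrow> complex"
  assumes exterior_riemann_map: "exterior_riemann_map \<Phi>"
begin

definition \<Psi> :: "complex \<Rightarrow> complex" where
  "\<Psi> = inv_into (- mandelbrot) \<Phi>"

lemma Phi_holomorphic: "\<Phi> holomorphic_on - mandelbrot"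
  and Phi_bij: "bij_betw \<Phi> (- mandelbrot) (- cball 0 1)"
  and Phi_at_infinity: "filterlim \<Phi> at_infinity at_infinity"
  and Phi_asymptotics: "((\<lambda>c. \<Phi> c / c) \<longlongrightarrow> 1) at_infinity"
  using exterior_riemann_map by (auto simp: exterior_riemann_map_def)

lemma norm_Phi: "c \<notin> mandelbrot \<Longrightarrow> 1 < norm (\<Phi> c)"
  using Phi_bij by (force simp: bij_betw_def)

lemma Psi_notin_mandelbrot: "1 < norm w \<Longrightarrow> \<Psi> w \<notin> mandelbrot"
  and Phi_Psi: "1 < norm w \<Longrightarrow> \<Phi> (\<Psi> w) = w"
  using Phi_bij inv_into_into[of w \<Phi> "- mandelbrot"] f_inv_into_f[of w \<Phi> "- mandelbrot"]
  by (auto simp: bij_betw_def \<Psi>_def)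

lemma Psi_Phi: "c \<notin> mandelbrot \<Longrightarrow> \<Psi> (\<Phi> c) = c"
  using Phi_bij by (simp add: \<Psi>_def bij_betw_def inv_into_f_f)

lemma Psi_holomorphic: "\<Psi> holomorphic_on - cball 0 1"
proof -
  have inj: "inj_on \<Phi> (- mandelbrot)" and im: "\<Phi> ` (- mandelbrot) = - cball 0 1"
    using Phi_bij by (auto simp: bij_betw_def)
  obtain g where g: "g holomorphic_on (\<Phi> ` (- mandelbrot))" "\<And>z. z \<in> - mandelbrot \<Longrightarrow> g (\<Phi> z) = z"
    using holomorphic_has_inverse[OF Phi_holomorphic _ inj] closed_mandelbrot by (metis open_Compl)
  have "\<Psi> w = g w" if "w \<in> - cball 0 1" for w
    using that g(2)[of "\<Psi> w"] Psi_notin_mandelbrot[of w] Phi_Psi[of w] by simp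
  thus ?thesis using g(1) im holomorphic_transform[of g "- cball 0 1" \<Psi>] by simp
qed

text \<open>
  In the coordinate \<open>1/z\<close> the map \<open>\<Phi>\<close> extends holomorphically by \<open>0 \<mapsto> 0\<close>. By the open mapping
  theorem every neighbourhood of infinity has an image that contains a neighbourhood of infinity, and
  injectivity of \<open>\<Phi>\<close> turns this into a statement on \<open>\<Psi>\<close>.
\<close>

lemma Psi_at_infinity: "filterlim \<Psi> at_infinity at_infinity"
  unfolding filterlim_at_infinity[OF order_refl]
proof (intro allI impI)
  fix R :: real assume "R > 0"
  \<comment> \<open>The radius 1/3 works because the Mandelbrot set lies in the disc of radius 2.\<close>
  define \<delta> where "\<delta> = min (1/3) (1 / R)"
  have \<delta>: "\<delta> > 0" "\<delta> \<le> 1/3" "\<delta> \<le> 1 / R" using \<open>R > 0\<close> by (auto simp: \<delta>_def)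
  define k where "k \<zeta> = (if \<zeta> = 0 then 0 else inverse (\<Phi> (inverse \<zeta>)))" for \<zeta>
  have M: "inverse \<zeta> \<notin> mandelbrot" if "\<zeta> \<noteq> 0" "norm \<zeta> < \<delta>" for \<zeta> :: complex
  proof -
    have "norm \<zeta> < 1/3" using that \<delta> by linarith
    hence "3 < norm (inverse \<zeta>)" using that unfolding norm_inverse by (simp add: field_simps)
    thus ?thesis using mandelbrot_subset_cball by force
  qed
  have hol: "k holomorphic_on ball 0 \<delta> - {0}"
  proof -
    have "(\<lambda>\<zeta>. inverse (\<Phi> (inverse \<zeta>))) holomorphic_on ball 0 \<delta> - {0}"
      using M norm_Phi
      by (intro holomorphic_intros holomorphic_on_compose_gen[OF _ Phi_holomorphic, unfolded o_def]) force+
    thus ?thesis by (rule holomorphic_transform) (auto simp: k_def)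
  qed
  have "((\<lambda>\<zeta>. inverse (\<Phi> (inverse \<zeta>))) \<longlongrightarrow> 0) (at 0)"
    by (intro tendsto_compose_filtermap[THEN iffD1] filterlim_compose[OF tendsto_inverse_0]
          filterlim_compose[OF Phi_at_infinity] filterlim_inverse_at_infinity)
  hence "(k \<longlongrightarrow> 0) (at 0)"
    by (rule Lim_transform_eventually) (auto simp: k_def eventually_at_filter)
  hence "isCont k 0" unfolding isCont_def by (simp add: k_def)
  moreover have "isCont k \<zeta>" if "\<zeta> \<in> ball 0 \<delta> - {0}" for \<zeta>
    using holomorphic_on_imp_continuous_on[OF hol] that by (simp add: continuous_on_eq_continuous_at open_delete)
  ultimately have "continuous_on (ball 0 \<delta>) k"
    by (metis Diff_iff continuous_at_imp_continuous_on singletonD)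
  hence kh: "k holomorphic_on ball 0 \<delta>"
    by (rule no_isolated_singularity[OF _ hol]) auto
  have "\<not> k constant_on ball 0 \<delta>"
  proof
    assume "k constant_on ball 0 \<delta>"
    moreover define a where "a = complex_of_real (\<delta>/2)"
    have a: "norm a = \<delta>/2" unfolding a_def norm_of_real using \<delta> by simp
    ultimately have "k a = k 0"
      using \<delta> unfolding constant_on_def by (metis a centre_in_ball field_sum_of_halves less_add_same_cancel1 half_gt_zero mem_ball_0)
    hence "\<Phi> (inverse a) = 0" using a \<delta> by (auto simp: k_def split: if_splits)
    moreover have "norm (\<Phi> (inverse a)) > 1" using a \<delta> by (intro norm_Phi M) auto
    ultimately show False by simp
  qed
  hence "open (k ` ball 0 \<delta>)"
    by (intro open_mapping_thm[OF kh]) auto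
  moreover have "0 \<in> k ` ball 0 \<delta>" using \<delta> by (auto simp: k_def image_iff intro!: bexI[of _ 0])
  ultimately obtain \<epsilon> where \<epsilon>: "\<epsilon> > 0" "ball 0 \<epsilon> \<subseteq> k ` ball 0 \<delta>" by (meson open_contains_ball)
  show "\<forall>\<^sub>F w in at_infinity. R \<le> norm (\<Psi> w)"
    unfolding eventually_at_infinity
  proof (intro exI allI impI)
    fix w :: complex assume w: "2 / \<epsilon> \<le> norm w"
    have "w \<noteq> 0" using w \<epsilon>(1) by (metis divide_pos_pos norm_zero not_le zero_less_numeral)
    moreover have "1 < norm w * \<epsilon>" using w \<epsilon>(1) by (simp add: field_simps)
    ultimately have "norm (inverse w) < \<epsilon>" unfolding norm_inverse by (simp add: field_simps)
    hence "inverse w \<in> ball 0 \<epsilon>" by simp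
    then obtain \<zeta> where z: "\<zeta> \<in> ball 0 \<delta>" "inverse w = k \<zeta>" using \<epsilon>(2) by blast
    have "\<zeta> \<noteq> 0" using z(2) \<open>w \<noteq> 0\<close> by (auto simp: k_def)
    hence "w = \<Phi> (inverse \<zeta>)" using z(2) by (simp add: k_def)
    hence "\<Psi> w = inverse \<zeta>" using M[of \<zeta>] z(1) \<open>\<zeta> \<noteq> 0\<close> by (simp add: Psi_Phi)
    moreover have "norm \<zeta> \<le> 1 / R" using z(1) \<delta>(3) by simp
    hence "R * norm \<zeta> \<le> 1" using \<open>R > 0\<close> by (simp add: field_simps)
    hence "R \<le> norm (inverse \<zeta>)" unfolding norm_inverse using \<open>\<zeta> \<noteq> 0\<close> by (simp add: field_simps)
    ultimately show "R \<le> norm (\<Psi> w)" by simp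
  qed
qed

text \<open>
  A function \<open>h\<close> on the complement of the Mandelbrot set, read in the coordinate \<open>\<zeta> = 1/\<Phi>\<close> of the unit
  disc. The value at 0 is the value at infinity of the functions \<open>h\<close> that occur.
\<close>

definition disc_pullback :: "(complex \<Rightarrow> complex) \<Rightarrow> complex \<Rightarrow> complex" where
  "disc_pullback h \<zeta> = (if \<zeta> = 0 then 1 else h (\<Psi> (inverse \<zeta>)))"

lemma norm_inverse_gt_1: "\<zeta> \<noteq> 0 \<Longrightarrow> norm \<zeta> < 1 \<Longrightarrow> 1 < norm (inverse (\<zeta>::complex))"
  by (simp add: norm_inverse one_less_inverse)

lemma disc_pullback_holomorphic:
  assumes h: "h holomorphic_on - mandelbrot" "(h \<longlongrightarrow> 1) at_infinity"
  shows "disc_pullback h holomorphic_on ball 0 1"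
proof -
  let ?k = "disc_pullback h"
  have hol: "?k holomorphic_on ball 0 1 - {0}"
  proof -
    have "(\<lambda>\<zeta>. h (\<Psi> (inverse \<zeta>))) holomorphic_on ball 0 1 - {0}"
      using Psi_notin_mandelbrot norm_inverse_gt_1
      by (intro holomorphic_intros holomorphic_on_compose_gen[OF _ h(1), unfolded o_def]
           holomorphic_on_compose_gen[OF _ Psi_holomorphic, unfolded o_def]) force+
    thus ?thesis by (rule holomorphic_transform) (auto simp: disc_pullback_def)
  qed
  have "((\<lambda>\<zeta>. h (\<Psi> (inverse \<zeta>))) \<longlongrightarrow> 1) (at 0)"
    by (intro filterlim_compose[OF h(2)] filterlim_compose[OF Psi_at_infinity] filterlim_inverse_at_infinity)
  hence "(?k \<longlongrightarrow> 1) (at 0)"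
    by (rule Lim_transform_eventually) (auto simp: disc_pullback_def eventually_at_filter)
  hence "isCont ?k 0" unfolding isCont_def by (simp add: disc_pullback_def)
  moreover have "isCont ?k \<zeta>" if "\<zeta> \<in> ball 0 1 - {0}" for \<zeta>
    using holomorphic_on_imp_continuous_on[OF hol] that by (simp add: continuous_on_eq_continuous_at open_delete)
  ultimately have "continuous_on (ball 0 1) ?k"
    by (metis Diff_iff continuous_at_imp_continuous_on singletonD)
  thus ?thesis by (rule no_isolated_singularity[OF _ hol]) auto
qed

section \<open>Growth of the critical orbit off the Mandelbrot set\<close>

text \<open>
  For \<open>T\<close> asymptotic to \<open>z^N\<close> at infinity, the exponent is chosen such that the quotient is 1 at infinity.
\<close>

definition relative_value :: "(complex \<Rightarrow> complex) \<Rightarrow> nat \<Rightarrow> nat \<Rightarrow> complex \<Rightarrow> complex" where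
  "relative_value T N n c = T (critical_orbit n c) / \<Phi> c ^ (N * 2 ^ n)"

lemma relative_value_holomorphic:
  assumes "T holomorphic_on UNIV"
  shows "relative_value T N n holomorphic_on - mandelbrot"
proof -
  have "\<Phi> c \<noteq> 0" if "c \<notin> mandelbrot" for c using norm_Phi[OF that] by auto
  thus ?thesis unfolding relative_value_def
    by (intro holomorphic_intros Phi_holomorphic
        holomorphic_on_compose_gen[OF _ assms, unfolded o_def]) auto
qed

lemma relative_value_at_infinity:
  assumes "((\<lambda>z. T z / z ^ N) \<longlongrightarrow> 1) at_infinity"
  shows "(relative_value T N n \<longlongrightarrow> 1) at_infinity"
proof -
  have 1: "((\<lambda>c. T (critical_orbit n c) / critical_orbit n c ^ N) \<longlongrightarrow> 1) at_infinity"
    by (rule filterlim_compose[OF assms critical_orbit_at_infinity])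
  have "((\<lambda>c. T (critical_orbit n c) / critical_orbit n c ^ N * (critical_orbit n c / c ^ (2 ^ n)) ^ N
          / (\<Phi> c / c) ^ (N * 2 ^ n)) \<longlongrightarrow> 1 * 1 ^ N / 1 ^ (N * 2 ^ n)) at_infinity"
    by (intro tendsto_intros 1 critical_orbit_asymptotics Phi_asymptotics) auto
  moreover have "\<forall>\<^sub>F c in at_infinity. T (critical_orbit n c) / critical_orbit n c ^ N *
      (critical_orbit n c / c ^ (2 ^ n)) ^ N / (\<Phi> c / c) ^ (N * 2 ^ n) = relative_value T N n c"
  proof -
    have "\<forall>\<^sub>F c in at_infinity. critical_orbit n c \<noteq> 0"
      using filterlim_at_infinity_imp_eventually_ne[OF critical_orbit_at_infinity] .
    thus ?thesis using eventually_not_equal_at_infinity[of 0]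
    proof eventually_elim
      case (elim c)
      have "c ^ (N * 2 ^ n) = (c ^ (2 ^ n)) ^ N" by (simp add: power_mult[symmetric] mult.commute)
      thus ?case using elim by (simp add: relative_value_def power_divide)
    qed
  qed
  ultimately show ?thesis by (simp add: Lim_transform_eventually)
qed

text \<open>
  The critical orbits of parameters in the Mandelbrot set stay in the disc of radius 2, which gives a bound
  that is independent of \<open>n\<close>.
\<close>

lemma relative_value_bound:
  assumes "T holomorphic_on UNIV" "((\<lambda>z. T z / z ^ N) \<longlongrightarrow> 1) at_infinity"
    and C: "1 \<le> C" "\<And>z. norm z \<le> 2 \<Longrightarrow> norm (T z) \<le> C" and c: "c \<notin> mandelbrot"
  shows "norm (relative_value T N n c) \<le> C"
proof (rule maximum_principle_exterior[OF closed_mandelbrot relative_value_holomorphic[OF assms(1)] _ _ _ C(1)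
    relative_value_at_infinity[OF assms(2)] c])
  have T: "continuous_on UNIV T" using assms(1) holomorphic_on_imp_continuous_on by blast
  show "continuous_on UNIV (\<lambda>c. T (critical_orbit n c))"
    by (rule continuous_on_compose2[OF T critical_orbit_continuous]) auto
  show "norm (T (critical_orbit n z)) \<le> C" if "z \<in> mandelbrot" for z
    using that by (intro C(2)) (simp add: mandelbrot_eq)
  show "norm (relative_value T N n z) \<le> norm (T (critical_orbit n z))" if "z \<notin> mandelbrot" for z
  proof -
    have "1 \<le> norm (\<Phi> z) ^ (N * 2 ^ n)" using norm_Phi[OF that] by (intro one_le_power) auto
    thus ?thesis unfolding relative_value_def norm_divide norm_power
      by (metis divide_right_mono div_by_1 frac_le norm_ge_zero order_refl zero_less_one)
  qed
qed

lemma critical_orbit_upper_bound: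
  assumes c: "c \<notin> mandelbrot"
  shows "norm (critical_orbit n c) \<le> 2 * norm (\<Phi> c) ^ (2 ^ n)"
proof -
  have "\<forall>\<^sub>F z in at_infinity. z / z ^ 1 = (1::complex)"
    using eventually_not_equal_at_infinity[of 0] by eventually_elim auto
  hence "((\<lambda>z. z / z ^ 1) \<longlongrightarrow> (1::complex)) at_infinity" by (rule tendsto_eventually)
  hence "norm (relative_value (\<lambda>z. z) 1 n c) \<le> 2"
    by (intro relative_value_bound c) (auto simp: holomorphic_on_ident)
  moreover have "norm (\<Phi> c) ^ (2 ^ n) > 0" using norm_Phi[OF c] by (intro zero_less_power) auto
  ultimately show ?thesis by (simp add: relative_value_def norm_divide norm_power field_simps)
qed

text \<open>
  Off the Mandelbrot set \<open>P\<^sub>n\<close> has no zeros, so \<open>P\<^sub>n / \<Phi>^(2^n)\<close> is nonvanishing, at most 2 in modulus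
  and 1 at infinity. The resulting constant does not depend on \<open>n\<close>, but it degenerates as \<open>c\<close> approaches
  the Mandelbrot set.
\<close>

lemma critical_orbit_lower_bound_const:
  assumes c: "c \<notin> mandelbrot"
  obtains \<kappa> where "\<kappa> > 0" "\<And>n. norm (critical_orbit n c) \<ge> \<kappa> * norm (\<Phi> c) ^ (2 ^ n)"
proof -
  define \<zeta> where "\<zeta> = inverse (\<Phi> c)"
  have z: "\<zeta> \<noteq> 0" "norm \<zeta> < 1"
    using norm_Phi[OF c] unfolding \<zeta>_def norm_inverse by (auto intro: inverse_less_1_iff[THEN iffD2])
  define \<kappa> where "\<kappa> = exp (- (4 * norm \<zeta> / (1 - norm \<zeta>)))"
  have id: "((\<lambda>z. z / z ^ 1) \<longlongrightarrow> (1::complex)) at_infinity"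
    by (rule tendsto_eventually, rule eventually_mono[OF eventually_not_equal_at_infinity[of 0]]) auto
  have "\<kappa> * norm (\<Phi> c) ^ (2 ^ n) \<le> norm (critical_orbit n c)" for n
  proof -
    let ?h = "relative_value (\<lambda>z. z) 1 n"
    have "norm (disc_pullback ?h \<zeta>) \<ge> \<kappa>"
      unfolding \<kappa>_def
    proof (rule nonvanishing_lower_bound[OF disc_pullback_holomorphic])
      show "?h holomorphic_on - mandelbrot"
        by (intro relative_value_holomorphic holomorphic_on_ident)
      show "(?h \<longlongrightarrow> 1) at_infinity" by (rule relative_value_at_infinity[OF id])
      show "disc_pullback ?h z \<noteq> 0" "norm (disc_pullback ?h z) \<le> 2" if "norm z < 1" for z
      proof -
        show "disc_pullback ?h z \<noteq> 0"
        proof (cases "z = 0")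
          case False
          note w = norm_inverse_gt_1[OF False that]
          show ?thesis using critical_orbit_nonzero[OF Psi_notin_mandelbrot[OF w]] Phi_Psi[OF w] False
            by (simp add: disc_pullback_def relative_value_def)
        qed (simp add: disc_pullback_def)
        show "norm (disc_pullback ?h z) \<le> 2"
        proof (cases "z = 0")
          case False
          note w = norm_inverse_gt_1[OF False that]
          have "norm (?h (\<Psi> (inverse z))) \<le> 2"
            by (intro relative_value_bound id Psi_notin_mandelbrot w) (auto simp: holomorphic_on_ident)
          thus ?thesis using False by (simp add: disc_pullback_def)
        qed (simp add: disc_pullback_def)
      qed
    qed (use z in \<open>auto simp: disc_pullback_def\<close>)
    moreover have "disc_pullback ?h \<zeta> = critical_orbit n c / \<Phi> c ^ (2 ^ n)"
      using z by (simp add: disc_pullback_def relative_value_def \<zeta>_def Psi_Phi c)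
    moreover have "norm (\<Phi> c) ^ (2 ^ n) > 0" using norm_Phi[OF c] by (intro zero_less_power) auto
    ultimately show ?thesis by (simp add: norm_divide norm_power field_simps)
  qed
  thus ?thesis using that[of \<kappa>] by (simp add: \<kappa>_def)
qed

text \<open>
  The recursion gives \<open>\<bar>P\<^bsub>n+1\<^esub>\<bar> + 3 \<le> (\<bar>P\<^sub>n\<bar> + 3)\<^sup>2\<close>, hence \<open>\<bar>P\<^bsub>n+k\<^esub>\<bar> + 3 \<le> (\<bar>P\<^sub>n\<bar> + 3)^(2^k)\<close>. Taking
  roots of order \<open>2^k\<close> as \<open>k\<close> grows removes the dependence of the constant in the previous lemma on \<open>c\<close>.
  This uniformity is what makes the bound usable at distance \<open>2^(-n)\<close> from the Mandelbrot set.
\<close>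

lemma critical_orbit_lower_bound:
  assumes c: "c \<notin> mandelbrot" "norm c \<le> 6"
  shows "norm (\<Phi> c) ^ (2 ^ n) \<le> norm (critical_orbit n c) + 3"
proof (rule ccontr)
  define b where "b = norm (critical_orbit n c) + 3"
  define X where "X = norm (\<Phi> c) ^ (2 ^ n)"
  assume "\<not> ?thesis"
  hence bX: "b < X" "b > 0" "X > 0" 
    using norm_ge_zero[of "critical_orbit n c"] unfolding b_def X_def by linarith+
  obtain \<kappa> where \<kappa>: "\<kappa> > 0" "\<And>n. norm (critical_orbit n c) \<ge> \<kappa> * norm (\<Phi> c) ^ (2 ^ n)"
    using critical_orbit_lower_bound_const c by metis
  have up: "norm (critical_orbit (n + k) c) + 3 \<le> b ^ (2 ^ k)" for k
  proof (induction k)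
    case (Suc k)
    let ?p = "norm (critical_orbit (n + k) c)"
    have "norm (critical_orbit (n + Suc k) c) + 3 \<le> ?p\<^sup>2 + 9"
      using norm_triangle_ineq[of "(critical_orbit (n + k) c)\<^sup>2" c] c(2)
      by (simp add: critical_orbit_Suc norm_power)
    also have "\<dots> \<le> (?p + 3)\<^sup>2" by (simp add: power2_eq_square algebra_simps)
    also have "\<dots> \<le> (b ^ (2 ^ k))\<^sup>2" using Suc by (intro power_mono) auto
    also have "\<dots> = b ^ (2 ^ Suc k)" by (simp add: power_mult[symmetric] mult.commute)
    finally show ?case .
  qed (simp add: b_def)
  have "(X / b) ^ (2 ^ k) \<le> 1 / \<kappa>" for k
  proof -
    have "\<kappa> * X ^ (2 ^ k) \<le> norm (critical_orbit (n + k) c)"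
      using \<kappa>(2)[of "n + k"] by (simp add: X_def power_add power_mult)
    also have "\<dots> \<le> b ^ (2 ^ k)" using up[of k] by simp
    finally show ?thesis using bX \<kappa>(1) by (simp add: power_divide field_simps)
  qed
  moreover obtain m where "1 / \<kappa> < (X / b) ^ m" using real_arch_pow[of "X / b"] bX by auto
  moreover have "(X / b) ^ m \<le> (X / b) ^ (2 ^ m)" using bX by (intro power_increasing) auto
  ultimately show False by (meson not_le order_trans)
qed

end

section \<open>Angles of rays that land at parameters with a small critical orbit\<close>

context exterior_uniformization
begin

lemma disc_pullback_bound:
  assumes "1 \<le> C" "\<And>c. c \<notin> mandelbrot \<Longrightarrow> norm (h c) \<le> C" "norm z < 1"
  shows "norm (disc_pullback h z) \<le> C"
proof (cases "z = 0")
  case False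
  thus ?thesis
    using assms norm_inverse_gt_1[of z] Psi_notin_mandelbrot[of "inverse z"] by (simp add: disc_pullback_def)
qed (use assms in \<open>simp add: disc_pullback_def\<close>)

lemma parameter_ray_eq: "parameter_ray \<Phi> t r = \<Psi> (of_real r * cis (2 * pi * t))"
  by (simp add: parameter_ray_def \<Psi>_def)

text \<open>
  As \<open>\<zeta> = 1/\<Phi>\<close> reverses angles, the double conjugation restores them: the radius of angle \<open>t\<close> now
  corresponds to the parameter ray of angle \<open>t\<close>.
\<close>

definition ray_profile :: "(complex \<Rightarrow> complex) \<Rightarrow> complex \<Rightarrow> complex" where
  "ray_profile h = cnj \<circ> disc_pullback h \<circ> cnj"

lemma ray_profile_holomorphic:
  assumes "h holomorphic_on - mandelbrot" "(h \<longlongrightarrow> 1) at_infinity"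
  shows "ray_profile h holomorphic_on ball 0 1"
proof -
  have "cnj ` ball 0 1 = ball 0 1"
    unfolding image_cnj_conv_vimage_cnj by auto
  thus ?thesis unfolding ray_profile_def
    using disc_pullback_holomorphic[OF assms] by (intro holomorphic_on_compose_cnj_cnj) auto
qed

lemma norm_ray_profile:
  assumes "0 < r"
  shows "norm (ray_profile h (of_real r * cis (2 * pi * t))) = norm (h (parameter_ray \<Phi> t (1 / r)))"
proof -
  have "inverse (cnj (of_real r * cis (2 * pi * t))) = of_real (1 / r) * cis (2 * pi * t)"
    using assms by (simp add: cis_cnj divide_simps flip: cis_inverse)
  moreover have "cnj (of_real r * cis (2 * pi * t)) \<noteq> 0" using assms by simp
  ultimately show ?thesis
    by (simp only: ray_profile_def o_def disc_pullback_def parameter_ray_eq if_False complex_mod_cnj)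
qed

text \<open>
  The growth of \<open>P\<^sub>n\<close> and the smallness of the radial limits can be compared at a single point because
  the constants can be chosen before the scale. Here \<open>X\<close> is a level at which the growth of \<open>P\<^sub>n\<close> and \<open>T\<close> gives a value of at least \<open>3/8\<close>, and \<open>\<kappa>\<close> is
  the ratio of the height of the test point to the length \<open>l\<close> of the dyadic interval. First \<open>X\<close> is
  chosen, then \<open>\<kappa>\<close> such that the angles outside the interval contribute at most \<open>1/32\<close>, and
  finally the density defect \<open>e\<close> such that the bad angles inside the interval contribute at most \<open>1/16\<close>.
  Only then does the interval, of length \<open>2^(-j)\<close>, determine the iterate \<open>n\<close>.
\<close>

proposition landing_angles_null:
  assumes T: "T holomorphic_on UNIV" "((\<lambda>z. T z / z ^ N) \<longlongrightarrow> 1) at_infinity"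
    and q: "q < 1/8" and S: "\<And>c n. c \<in> S \<Longrightarrow> 1 \<le> n \<Longrightarrow> norm (T (critical_orbit n c)) \<le> q"
  shows "landing_angles \<Phi> S \<in> null_sets lebesgue"
proof -
  have Tc: "continuous_on A T" for A
    using T(1) holomorphic_on_imp_continuous_on continuous_on_subset by blast
  obtain C0 where C0: "\<And>z. norm z \<le> 2 \<Longrightarrow> norm (T z) \<le> C0"
  proof -
    have "bounded (T ` cball 0 2)"
      using compact_continuous_image[OF Tc compact_cball] compact_imp_bounded by blast
    then obtain B where "\<forall>x\<in>T ` cball 0 2. norm x \<le> B" unfolding bounded_iff by blast
    thus ?thesis by (intro that[of B]) auto
  qed
  define C where "C = max 1 C0"
  have C: "1 \<le> C" "\<And>z. norm z \<le> 2 \<Longrightarrow> norm (T z) \<le> C" using C0 by (force simp: C_def max_def)+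
  define h where "h n = relative_value T N n" for n
  define f where "f n = ray_profile (h n)" for n
  have hol: "f n holomorphic_on ball 0 1" for n
    unfolding f_def h_def by (intro ray_profile_holomorphic relative_value_holomorphic relative_value_at_infinity T)
  have fC: "norm (f n z) \<le> C" if "norm z < 1" for n z
    using that C unfolding f_def h_def ray_profile_def
    by (auto intro!: disc_pullback_bound relative_value_bound T)
  define L where "L = {0..1} \<inter> (\<Inter>n\<in>{1..}. \<Union>N. radially_small (f n) (1/8) N)"
  have closedR: "closed (radially_small (f n) (1/8) N)" for n N
    by (intro closed_radially_small holomorphic_on_imp_continuous_on hol)
  have Lsets: "L \<in> sets lebesgue"
    unfolding L_def using closedR by (intro sets.Int sets.countable_INT'' sets.countable_UN) (auto intro: borel_closed)
  have LD: "\<forall>\<^sub>F r in at_left 1. norm (f n (of_real r * cis (2 * pi * t))) \<le> 1/8" if "t \<in> L" "1 \<le> n" for t n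
    using that UN_radially_small[of "f n" "1/8"] unfolding L_def by blast
  have "landing_angles \<Phi> S \<subseteq> L"
  proof
    fix t assume "t \<in> landing_angles \<Phi> S"
    then obtain c where t: "t \<in> {0..<1}" and c: "c \<in> S" "(parameter_ray \<Phi> t \<longlongrightarrow> c) (at_right 1)"
      by (auto simp: landing_angles_def ray_lands_at_def)
    have "\<forall>\<^sub>F r in at_left 1. norm (f n (of_real r * cis (2 * pi * t))) \<le> 1/8" if n: "1 \<le> n" for n
    proof -
      have "continuous_on UNIV (\<lambda>c. T (critical_orbit n c))"
        by (rule continuous_on_compose2[OF Tc critical_orbit_continuous]) auto
      hence "isCont (\<lambda>c. T (critical_orbit n c)) c" by (simp add: continuous_on_eq_continuous_at)
      from isCont_tendsto_compose[OF this c(2)]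
      have "((\<lambda>r. norm (T (critical_orbit n (parameter_ray \<Phi> t r)))) \<longlongrightarrow> norm (T (critical_orbit n c))) (at_right 1)"
        by (rule tendsto_norm)
      moreover have "norm (T (critical_orbit n c)) < 1/8" using S[OF c(1) n] q by linarith
      ultimately have ev: "\<forall>\<^sub>F r in at_right 1. norm (T (critical_orbit n (parameter_ray \<Phi> t r))) < 1/8"
        by (rule order_tendstoD(2))
      have "filterlim (\<lambda>r::real. 1 / r) (at_right 1) (at_left 1)" by real_asymp
      from eventually_compose_filterlim[OF ev this]
      have "\<forall>\<^sub>F r in at_left 1. norm (T (critical_orbit n (parameter_ray \<Phi> t (1 / r)))) < 1/8" .
      moreover have "\<forall>\<^sub>F r in at_left (1::real). 0 < r \<and> r < 1"
        unfolding eventually_at_left_field by (rule exI[of _ 0]) auto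
      ultimately show ?thesis
      proof eventually_elim
        case (elim r)
        define w where "w = of_real (1 / r) * cis (2 * pi * t)"
        have w: "1 < norm w" using elim(2) by (simp add: w_def norm_mult norm_divide)
        have ray: "parameter_ray \<Phi> t (1 / r) = \<Psi> w" by (simp only: parameter_ray_eq w_def)
        have "1 \<le> norm w ^ (N * 2 ^ n)" using w by (intro one_le_power) auto
        hence "norm (h n (\<Psi> w)) \<le> norm (T (critical_orbit n (\<Psi> w)))"
          unfolding h_def relative_value_def norm_divide norm_power Phi_Psi[OF w]
          by (metis div_by_1 frac_le norm_ge_zero order_refl zero_less_one)
        also have "\<dots> \<le> 1/8" using elim(1) unfolding ray by simp
        finally show ?case using elim(2) unfolding f_def by (simp add: norm_ray_profile ray del: of_real_divide)
      qed
    qed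
    thus "t \<in> L" using t UN_radially_small[of "f n" "1/8" for n] unfolding L_def by auto
  qed
  moreover have "L \<in> null_sets lebesgue"
  proof (rule ccontr)
    assume nonnull: "L \<notin> null_sets lebesgue"
    have "\<forall>\<^sub>F z in at_infinity. dist (T z / z ^ N) 1 < 1/4" using T(2) by (rule tendstoD) simp
    then obtain Z0 where Z0: "\<And>z. norm z \<ge> Z0 \<Longrightarrow> dist (T z / z ^ N) 1 < 1/4"
      by (auto simp: eventually_at_infinity)
    define Z where "Z = max 1 Z0"
    have Z: "norm (T z) \<ge> 3/4 * norm z ^ N" if "norm z \<ge> Z" for z
    proof -
      have "dist (T z / z ^ N) 1 < 1/4" using that Z0 by (simp add: Z_def)
      hence "norm (T z / z ^ N) \<ge> 3/4"
        using norm_triangle_ineq2[of 1 "1 - T z / z ^ N"] by (simp add: dist_norm norm_minus_commute)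
      moreover have "norm z ^ N > 0" using that by (intro zero_less_power) (auto simp: Z_def)
      ultimately show ?thesis by (simp add: norm_divide norm_power field_simps)
    qed
    have "((\<lambda>X::real. 3 / X) \<longlongrightarrow> 0) at_top" by real_asymp
    hence "((\<lambda>X::real. (1 - 3 / X) ^ N) \<longlongrightarrow> (1 - 0) ^ N) at_top" by (intro tendsto_intros)
    hence "\<forall>\<^sub>F X::real in at_top. 1/2 < (1 - 3 / X) ^ N" by (rule order_tendstoD(1)) simp
    hence "\<forall>\<^sub>F X::real in at_top. 1/2 < (1 - 3 / X) ^ N \<and> X \<ge> Z + 3"
      using eventually_ge_at_top[of "Z + 3"] by eventually_elim auto
    then obtain X :: real where X: "1/2 < (1 - 3 / X) ^ N" "X \<ge> Z + 3"
      using eventually_happens'[OF trivial_limit_at_top_linorder] by blast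
    have X4: "X \<ge> 4" using X(2) by (simp add: Z_def)
    \<comment> \<open>A test point at level \<open>X\<close> satisfies \<open>\<bar>\<Phi>\<bar> = exp (A / 2^n)\<close>.\<close>
    define A where "A = ln X"
    have A: "A > 0" "exp A = X" using X4 by (auto simp: A_def)
    define \<eta> where "\<eta> = min (1/2) (1 / (32 * C * pi))"
    have \<eta>: "\<eta> > 0" "\<eta> \<le> 1/2" "\<eta> \<le> 1 / (32 * C * pi)" using C(1) by (auto simp: \<eta>_def)
    obtain m0 where m0: "A / \<eta> < 2 ^ m0" using real_arch_pow[of 2 "A / \<eta>"] by auto
    define m where "m = Suc m0"
    define \<kappa> where "\<kappa> = A / 2 ^ m"
    have "A < \<eta> * 2 ^ m0" using m0 \<eta>(1) by (simp add: field_simps)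
    also have "\<dots> \<le> \<eta> * 2 ^ m" using \<eta>(1) by (simp add: m_def)
    finally have "\<kappa> \<le> \<eta>" by (simp add: \<kappa>_def field_simps)
    hence \<kappa>: "0 < \<kappa>" "\<kappa> \<le> 1/2" "C * pi * \<kappa> \<le> 1/32"
    proof -
      show "0 < \<kappa>" using A by (simp add: \<kappa>_def)
      show "\<kappa> \<le> 1/2" using \<open>\<kappa> \<le> \<eta>\<close> \<eta> by linarith
      have "\<kappa> \<le> 1 / (32 * C * pi)" using \<open>\<kappa> \<le> \<eta>\<close> \<eta> by linarith
      thus "C * pi * \<kappa> \<le> 1/32" using C(1) by (simp add: field_simps)
    qed
    define e where "e = \<kappa> / (64 * C)"
    have e: "e > 0" using \<kappa> C(1) by (simp add: e_def)
    have "L \<subseteq> {0..1}" by (simp add: L_def)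
    then obtain u v j where uv: "u < v" "v - u = 1 / 2 ^ (j::nat)" "measure lebesgue ({u..v} - L) \<le> e * (v - u)"
      using dense_dyadic_interval[OF Lsets _ nonnull e] by blast
    define l where "l = v - u"
    have l: "0 < l" "l \<le> 1" using uv by (auto simp: l_def)
    \<comment> \<open>With this \<open>n\<close> the height \<open>A / 2^n\<close> is \<open>\<kappa>\<close> times the length of the interval.\<close>
    define n where "n = j + m"
    have n: "1 \<le> n" by (simp add: n_def m_def)
    define y where "y = \<kappa> * l"
    have y: "0 < y" "y \<le> 1/2" using \<kappa> l mult_mono[of \<kappa> "1/2" l 1] by (auto simp: y_def)
    have yA: "y * 2 ^ n = A" unfolding y_def \<kappa>_def l_def uv(2) n_def by (simp add: power_add)
    define s where "s = exp (- y)"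
    have s1: "1 - s \<le> y" using exp_ge_add_one_self[of "- y"] by (simp add: s_def)
    have s2: "y / 2 \<le> 1 - s"
    proof -
      have "s = 1 / exp y" by (simp add: s_def exp_minus inverse_eq_divide)
      also have "\<dots> \<le> 1 / (1 + y)" using y exp_ge_add_one_self[of y] by (intro frac_le) auto
      also have "\<dots> \<le> 1 - y / 2"
      proof -
        have "y * y \<le> y * 1" using y by (intro mult_left_mono) auto
        hence "1 \<le> (1 - y / 2) * (1 + y)" by (simp add: algebra_simps)
        thus ?thesis using y by (simp add: pos_divide_le_eq)
      qed
      finally show ?thesis by simp
    qed
    have s: "1/2 \<le> s" "s < 1" using s1 s2 y by linarith+
    define t where "t = (u + v) / 2"
    have "norm (f n (of_real s * cis (2 * pi * t))) \<le> 1/8 + C * pi * (1 - s) / (v - u)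
           + 2 * C / (1 - s) * measure lebesgue ({u..v} - L)"
      unfolding t_def
      by (rule radial_bound[OF hol fC s uv(1) _ Lsets _ LD[OF _ n]]) (use l in \<open>auto simp: l_def\<close>)
    also have "C * pi * (1 - s) / (v - u) \<le> 1/32"
    proof -
      have "C * pi * (1 - s) / l \<le> C * pi * y / l"
        using s1 C(1) l by (intro divide_right_mono mult_left_mono) auto
      also have "\<dots> = C * pi * \<kappa>" using l by (simp add: y_def)
      also have "\<dots> \<le> 1/32" by (rule \<kappa>(3))
      finally show ?thesis unfolding l_def .
    qed
    also have "2 * C / (1 - s) * measure lebesgue ({u..v} - L) \<le> 1/16"
    proof -
      have "2 * C / (1 - s) * measure lebesgue ({u..v} - L) \<le> 2 * C / (y / 2) * (e * l)"
        using s2 y C(1) uv(3) unfolding l_def by (intro mult_mono frac_le) auto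
      also have "\<dots> = 1/16" using \<kappa> l C(1) by (simp add: y_def e_def)
      finally show ?thesis .
    qed
    finally have upper: "norm (f n (of_real s * cis (2 * pi * t))) \<le> 1/8 + 1/32 + 1/16" by simp
    define w where "w = of_real (1 / s) * cis (2 * pi * t)"
    define c where "c = \<Psi> w"
    have "norm w = 1 / s" using s by (simp add: w_def norm_mult norm_divide)
    hence nw: "norm w = exp y" 
      by (simp only: s_def exp_minus divide_inverse inverse_inverse_eq mult_1)
    hence w: "1 < norm w" using y by simp
    have c: "c \<notin> mandelbrot" "\<Phi> c = w" unfolding c_def using Psi_notin_mandelbrot Phi_Psi w by auto
    have "norm w \<le> 1 / (1/2)" unfolding \<open>norm w = 1 / s\<close> using s by (intro frac_le) auto
    hence "norm w \<le> 2" by simp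
    hence c6: "norm c \<le> 6" using critical_orbit_upper_bound[OF c(1), of 0] c(2) by simp
    have wX: "norm w ^ (2 ^ n) = X"
    proof -
      have "norm w ^ (2 ^ n) = exp (real (2 ^ n) * y)" unfolding nw exp_of_nat_mult ..
      thus ?thesis using yA A(2) by (simp add: mult.commute)
    qed
    have P: "X - 3 \<le> norm (critical_orbit n c)"
      using critical_orbit_lower_bound[OF c(1) c6, of n] unfolding c(2) wX by linarith
    have "3/4 * (X - 3) ^ N \<le> 3/4 * norm (critical_orbit n c) ^ N"
      using P X4 by (intro mult_left_mono power_mono) auto
    also have "\<dots> \<le> norm (T (critical_orbit n c))" using P X(2) by (intro Z) linarith
    finally have "3/4 * (X - 3) ^ N / X ^ N \<le> norm (T (critical_orbit n c)) / X ^ N"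
      using X4 by (intro divide_right_mono) auto
    also have "\<dots> = norm (h n c)"
      unfolding h_def relative_value_def norm_divide norm_power c(2)
      by (simp add: wX[symmetric] power_mult[symmetric] mult.commute)
    also have "\<dots> = norm (f n (of_real s * cis (2 * pi * t)))"
      using s unfolding f_def c_def w_def parameter_ray_eq[symmetric] by (simp add: norm_ray_profile)
    finally have "3/4 * ((X - 3) / X) ^ N \<le> 7/32" using upper by (simp add: power_divide)
    moreover have "(X - 3) / X = 1 - 3 / X" using X4 by (simp add: field_simps)
    ultimately show False using X(1) by simp
  qed
  ultimately show ?thesis by (metis negligible_iff_null_sets negligible_subset)
qed

end

section \<open>The real slice has harmonic measure zero\<close>

text \<open>
  The polynomial \<open>a^(2^k) * C(z / a)\<close>, where \<open>C\<close> is the \<open>k\<close>-fold iterate of \<open>z\<^sup>2 - 2\<close>, which is the monic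
  Chebyshev polynomial of degree \<open>2^k\<close> of the interval \<open>[-2, 2]\<close>. For \<open>a < 1\<close> its maximum on
  \<open>[-2a, 2a]\<close> tends to 0 as \<open>k\<close> grows.
\<close>

fun scaled_chebyshev :: "real \<Rightarrow> nat \<Rightarrow> complex \<Rightarrow> complex" where
  "scaled_chebyshev a 0 z = z"
| "scaled_chebyshev a (Suc k) z = (scaled_chebyshev a k z)\<^sup>2 - 2 * of_real (a ^ (2 ^ Suc k))"

lemma scaled_chebyshev_holomorphic: "scaled_chebyshev a k holomorphic_on A"
proof (induction k)
  case 0
  have "scaled_chebyshev a 0 = (\<lambda>z. z)" by auto
  then show ?case by (simp add: holomorphic_on_ident)
next
  case (Suc k)
  have "scaled_chebyshev a (Suc k) = (\<lambda>z. (scaled_chebyshev a k z)\<^sup>2 - 2 * of_real (a ^ (2 ^ Suc k)))" by auto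
  with Suc show ?case by (auto intro!: holomorphic_intros)
qed

lemma scaled_chebyshev_asymptotics:
  "((\<lambda>z. scaled_chebyshev a k z / z ^ (2 ^ k)) \<longlongrightarrow> 1) at_infinity"
proof (induction k)
  case 0
  have "\<forall>\<^sub>F c in at_infinity. scaled_chebyshev a 0 c / c ^ (2 ^ 0) = 1"
    using eventually_not_equal_at_infinity[of 0] by eventually_elim auto
  thus ?case by (rule tendsto_eventually)
next
  case (Suc k)
  let ?b = "2 * of_real (a ^ (2 ^ Suc k)) :: complex"
  have "((\<lambda>z. (scaled_chebyshev a k z / z ^ (2 ^ k))\<^sup>2 - ?b * inverse z ^ (2 ^ Suc k)) \<longlongrightarrow> 1\<^sup>2 - ?b * 0 ^ (2 ^ Suc k))
          at_infinity"
    by (intro tendsto_intros Suc tendsto_inverse_0)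
  moreover have "(scaled_chebyshev a k z / z ^ (2 ^ k))\<^sup>2 - ?b * inverse z ^ (2 ^ Suc k)
       = scaled_chebyshev a (Suc k) z / z ^ (2 ^ Suc k)" for z
  proof -
    have "(scaled_chebyshev a k z / z ^ (2 ^ k))\<^sup>2 = (scaled_chebyshev a k z)\<^sup>2 / z ^ (2 ^ Suc k)"
      by (simp add: power_divide power_mult[symmetric] mult.commute)
    moreover have "?b * inverse z ^ (2 ^ Suc k) = ?b / z ^ (2 ^ Suc k)"
      by (simp only: power_inverse divide_inverse)
    ultimately show ?thesis by (simp only: scaled_chebyshev.simps(2) diff_divide_distrib)
  qed
  ultimately show ?case by (simp add: power_0_left)
qed

lemma scaled_chebyshev_bound:
  assumes "0 \<le> a" "\<bar>x\<bar> \<le> 2 * a"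
  obtains y where "scaled_chebyshev a k (of_real x) = of_real y" "\<bar>y\<bar> \<le> 2 * a ^ (2 ^ k)"
proof -
  have "\<exists>y. scaled_chebyshev a k (of_real x) = of_real y \<and> \<bar>y\<bar> \<le> 2 * a ^ (2 ^ k)"
  proof (induction k)
    case (Suc k)
    then obtain y where y: "scaled_chebyshev a k (of_real x) = of_real y" "\<bar>y\<bar> \<le> 2 * a ^ (2 ^ k)" by auto
    have eq: "(a ^ (2 ^ k))\<^sup>2 = a ^ (2 ^ Suc k)" by (simp add: power_mult[symmetric] mult.commute)
    have "y\<^sup>2 \<le> (2 * a ^ (2 ^ k))\<^sup>2" using y(2) assms by (intro iffD1[OF abs_le_square_iff]) auto
    hence "y\<^sup>2 \<le> 4 * a ^ (2 ^ Suc k)" unfolding power_mult_distrib eq by simp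
    moreover have "0 \<le> y\<^sup>2" by simp
    ultimately have "\<bar>y\<^sup>2 - 2 * a ^ (2 ^ Suc k)\<bar> \<le> 2 * a ^ (2 ^ Suc k)" by linarith
    thus ?case using y(1) by (intro exI[of _ "y\<^sup>2 - 2 * a ^ (2 ^ Suc k)"]) simp
  qed (use assms in auto)
  thus ?thesis using that by blast
qed

theorem theorem1p1:
  fixes \<Phi> :: "complex \<Rightarrow> complex"
  assumes "exterior_riemann_map \<Phi>"
  shows "mandelbrot \<inter> \<real> = complex_of_real ` {-2..1/4}
    \<and> harmonic_measure \<Phi> (complex_of_real ` {-2..1/4}) = 0
    \<and> landing_angles \<Phi> (complex_of_real ` {-2..1/4}) \<in> null_sets lebesgue"
proof -
  interpret exterior_uniformization \<Phi> using assms by unfold_locales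
  have tip: "landing_angles \<Phi> {-2} \<in> null_sets lebesgue"
  proof (rule landing_angles_null)
    show "(\<lambda>z. z - 2) holomorphic_on UNIV" by (intro holomorphic_intros)
    have "((\<lambda>z. 1 - 2 * inverse z) \<longlongrightarrow> 1 - 2 * (0::complex)) at_infinity"
      by (intro tendsto_intros tendsto_inverse_0)
    moreover have "\<forall>\<^sub>F z in at_infinity. 1 - 2 * inverse z = (z - 2) / (z :: complex) ^ 1"
      using eventually_not_equal_at_infinity[of 0] by eventually_elim (simp add: field_simps)
    ultimately show "((\<lambda>z. (z - 2) / z ^ 1) \<longlongrightarrow> (1::complex)) at_infinity"
      by (simp add: Lim_transform_eventually)
    \<comment> \<open>The orbit of \<open>-2\<close> is \<open>-2, 2, 2, 2, ...\<close>.\<close>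
    have "critical_orbit (Suc n) (-2) = 2" for n
      by (induction n) (simp_all add: critical_orbit_Suc)
    thus "norm (critical_orbit n c - 2) \<le> 0" if "c \<in> {-2}" "1 \<le> n" for c n
      using that by (cases n) auto
  qed simp
  have rest: "landing_angles \<Phi> (complex_of_real ` {-2 + 1 / real (Suc k)..1/4}) \<in> null_sets lebesgue" for k
  proof -
    define a where "a = 1 - 1 / (2 * real (Suc k))"
    have a: "1/2 \<le> a" "a < 1" "2 - 1 / real (Suc k) = 2 * a" by (auto simp: a_def field_simps)
    obtain i where "a ^ i < 1/32" using real_arch_pow_inv[of "1/32" a] a by auto
    moreover have "a ^ (2 ^ i) \<le> a ^ i" using a by (intro power_decreasing) auto
    ultimately have i: "2 * a ^ (2 ^ i) < 1/8" by simp
    show ?thesis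
    proof (rule landing_angles_null[OF scaled_chebyshev_holomorphic scaled_chebyshev_asymptotics i])
      fix c n assume "c \<in> complex_of_real ` {-2 + 1 / real (Suc k)..1/4}"
      then obtain x where x: "c = of_real x" "-2 + 1 / real (Suc k) \<le> x" "x \<le> 1/4" by auto
      hence "\<bar>x\<bar> \<le> 2 * a" using a by linarith
      have "-2 \<le> x" using x(2) by (smt (verit) divide_nonneg_nonneg of_nat_0_le_iff)
      then obtain y where y: "critical_orbit n c = of_real y" "\<bar>y\<bar> \<le> max \<bar>x\<bar> (1/2)"
        using critical_orbit_real x(1,3) by blast
      hence "\<bar>y\<bar> \<le> 2 * a" using \<open>\<bar>x\<bar> \<le> 2 * a\<close> a by linarith
      then obtain z where "scaled_chebyshev a i (of_real y) = of_real z" "\<bar>z\<bar> \<le> 2 * a ^ (2 ^ i)"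
        using scaled_chebyshev_bound a by (metis dual_order.trans half_gt_zero_iff less_eq_real_def zero_less_one)
      thus "norm (scaled_chebyshev a i (critical_orbit n c)) \<le> 2 * a ^ (2 ^ i)" using y(1) by simp
    qed
  qed
  have cover: "complex_of_real ` {-2..1/4} \<subseteq> {-2} \<union> (\<Union>k. complex_of_real ` {-2 + 1 / real (Suc k)..1/4})"
  proof
    fix c assume "c \<in> complex_of_real ` {-2..1/4}"
    then obtain x where x: "c = of_real x" "-2 \<le> x" "x \<le> 1/4" by auto
    show "c \<in> {-2} \<union> (\<Union>k. complex_of_real ` {-2 + 1 / real (Suc k)..1/4})"
    proof (cases "x = -2")
      case False
      hence "0 < x + 2" using x by simp
      then obtain k where "inverse (real (Suc k)) < x + 2" using reals_Archimedean by blast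
      hence "x \<in> {-2 + 1 / real (Suc k)..1/4}" using x by (simp add: inverse_eq_divide)
      thus ?thesis using x(1) by blast
    qed (use x in simp)
  qed
  have "landing_angles \<Phi> (complex_of_real ` {-2..1/4}) \<subseteq>
      landing_angles \<Phi> {-2} \<union> (\<Union>k. landing_angles \<Phi> (complex_of_real ` {-2 + 1 / real (Suc k)..1/4}))"
  proof
    fix t assume "t \<in> landing_angles \<Phi> (complex_of_real ` {-2..1/4})"
    then obtain c where c: "c \<in> complex_of_real ` {-2..1/4}" "t \<in> {0..<1}" "ray_lands_at \<Phi> t c"
      unfolding landing_angles_def by blast
    have in_angles: "t \<in> landing_angles \<Phi> S" if "c \<in> S" for S
      using that c(2,3) unfolding landing_angles_def by blast
    from c(1) cover have "c \<in> {-2} \<or> (\<exists>k. c \<in> complex_of_real ` {-2 + 1 / real (Suc k)..1/4})" by blast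
    thus "t \<in> landing_angles \<Phi> {-2} \<union> (\<Union>k. landing_angles \<Phi> (complex_of_real ` {-2 + 1 / real (Suc k)..1/4}))"
      using in_angles by blast
  qed
  moreover have "landing_angles \<Phi> {-2} \<union> (\<Union>k. landing_angles \<Phi> (complex_of_real ` {-2 + 1 / real (Suc k)..1/4}))
      \<in> null_sets lebesgue"
    by (intro null_sets.Un tip null_sets_UN rest)
  ultimately have null: "landing_angles \<Phi> (complex_of_real ` {-2..1/4}) \<in> null_sets lebesgue"
    by (metis negligible_iff_null_sets negligible_subset)
  hence "harmonic_measure \<Phi> (complex_of_real ` {-2..1/4}) = 0"
    unfolding harmonic_measure_def by (rule null_setsD1)
  with null show ?thesis using mandelbrot_real_slice by blast
qed

end
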